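(* Let $U\subset\mathbb{C}$ be a hyperbolic domain and let $f:U\to U$ be a holomorphic map such that $f^n\to\infty$ as $n\to\infty$ almost uniformly on $U$, and suppose that $\infty$ is not an isolated point of the boundary of $U$ in $\overline{\mathbb{C}}$. If $f$ is of parabolic I type, then there exists a nice simply connected absorbing domain $W$ in $U$ for $f$.
   Context: A domain $U\subset\mathbb{C}$ is hyperbolic if $\mathbb{C}\setminus U$ contains at least two points. $f^n$ is the $n$-th iterate and $\overline{\mathbb{C}}$ is the Riemann sphere. "Almost uniformly" means uniformly on compact subsets. Absorbing domain: for a domain $D$ and a holomorphic map $h:D\to D$, a domain $W\subset D$ is absorbing in $D$ for $h$ if $h(W)\subset W$ and for every compact $K\subset D$ there is $n\ge 0$ with $h^n(K)\subset W$. Nice absorbing domain: an absorbing domain $W$ in $U$ for $f$ (with $f^n\to\infty$) is nice if (a) $\overline{W}\subset U$; (b) $f^n(\overline{W})=\overline{f^n(W)}\subset f^{n-1}(W)$ for every $n\ge 1$; (c) $\bigcap_{n=1}^\infty f^n(\overline{W})=\emptyset$. Closures are taken in $\mathbb{C}$. Type of $f$ (note that $f$ has no fixed points since $f^n\to\infty$): let $\mathbb{H}$ be the right half-plane, $\pi:\mathbb{H}\to U$ a holomorphic universal covering and $g:\mathbb{H}\to\mathbb{H}$ a lift of $f$, i.e. $\pi\circ g=f\circ\pi$. Then $g$ has no fixed points, and $g^n$ converges almost uniformly to a point of the boundary of $\mathbb{H}$ in $\overline{\mathbb{C}}$; conjugating by a Möbius map we may assume this point is $\infty$. By a theorem of Cowen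 there exist a simply connected domain $V\subset\mathbb{H}$, a domain $\Omega\in\{\mathbb{H},\mathbb{C}\}$, a holomorphic map $\varphi:\mathbb{H}\to\Omega$ and a Möbius transformation $T$ of $\Omega$ onto itself such that $V$ is absorbing in $\mathbb{H}$ for $g$, $\varphi(V)$ is absorbing in $\Omega$ for $T$, $\varphi\circ g=T\circ\varphi$ on $\mathbb{H}$, and $\varphi$ is univalent on $V$. Up to conjugation of $T$ by a Möbius transformation preserving $\Omega$, one of the following holds: $\Omega=\mathbb{C}$, $T(\omega)=\omega+1$ (parabolic I type); $\Omega=\mathbb{H}$, $T(\omega)=\omega\pm i$ (parabolic II type); $\Omega=\mathbb{H}$, $T(\omega)=a\omega$ for some $a>1$ (hyperbolic type). The type depends only on $f$ (not on $\pi$, $g$, $V$, $\varphi$), and it is called the type of $f$. *)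

theory Defs
  imports "HOL-Complex_Analysis.Complex_Analysis"
begin

definition plane_domain :: "complex set \<Rightarrow> bool" where
  "plane_domain D \<longleftrightarrow> open D \<and> connected D \<and> D \<noteq> {}"

definition hyperbolic_domain :: "complex set \<Rightarrow> bool" where
  "hyperbolic_domain U \<longleftrightarrow> plane_domain U \<and> (\<exists>a b. a \<noteq> b \<and> a \<notin> U \<and> b \<notin> U)"

text \<open>The Riemann sphere is the one-point compactification of the plane; its point at
  infinity is \<^term>\<open>None\<close>.\<close>

abbreviation riemann_sphere :: "complex option topology" where
  "riemann_sphere \<equiv> Alexandroff_compactification euclidean"

definition isolated_point_of :: "'a topology \<Rightarrow> 'a set \<Rightarrow> 'a \<Rightarrow> bool" where
  "isolated_point_of X S x \<longleftrightarrow> x \<in> S - X derived_set_of S"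

text \<open>Uniform convergence of the iterates to infinity on compact subsets of \<open>D\<close>.
  The sets of all \<open>w\<close> with \<open>R < norm w\<close>, together with the point at infinity, form a
  neighbourhood base at infinity in the sphere.\<close>

definition iterates_tend_to_infinity :: "complex set \<Rightarrow> (complex \<Rightarrow> complex) \<Rightarrow> bool" where
  "iterates_tend_to_infinity D h \<longleftrightarrow>
     (\<forall>K. compact K \<and> K \<subseteq> D \<longrightarrow>
        (\<forall>R::real. \<forall>\<^sub>F n in sequentially. \<forall>z\<in>K. R < norm ((h ^^ n) z)))"

definition absorbing_domain ::
    "complex set \<Rightarrow> complex set \<Rightarrow> (complex \<Rightarrow> complex) \<Rightarrow> bool" where
  "absorbing_domain W D h \<longleftrightarrow>
     plane_domain W \<and> W \<subseteq> D \<and> h ` W \<subseteq> W \<and>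
     (\<forall>K. compact K \<and> K \<subseteq> D \<longrightarrow> (\<exists>n. (h ^^ n) ` K \<subseteq> W))"

definition nice_absorbing_domain ::
    "complex set \<Rightarrow> complex set \<Rightarrow> (complex \<Rightarrow> complex) \<Rightarrow> bool" where
  "nice_absorbing_domain W U f \<longleftrightarrow>
     absorbing_domain W U f \<and>
     closure W \<subseteq> U \<and>
     (\<forall>n\<ge>1. (f ^^ n) ` closure W = closure ((f ^^ n) ` W) \<and>
             closure ((f ^^ n) ` W) \<subseteq> (f ^^ (n - 1)) ` W) \<and>
     (\<Inter>n\<in>{1..}. (f ^^ n) ` closure W) = {}"

definition right_half_plane :: "complex set" where
  "right_half_plane = {z. Re z > 0}"

definition moebius_onto_self :: "complex set \<Rightarrow> (complex \<Rightarrow> complex) \<Rightarrow> bool" where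
  "moebius_onto_self \<Omega> T \<longleftrightarrow>
     (\<exists>a b c d. a * d - b * c \<noteq> 0 \<and>
        (\<forall>z\<in>\<Omega>. c * z + d \<noteq> 0 \<and> T z = moebius a b c d z)) \<and>
     T ` \<Omega> = \<Omega>"

text \<open>The half-plane is simply connected, so a covering map defined on it is universal.
  The lift is normalised so that its Denjoy--Wolff point is infinity.\<close>

definition normalized_lift ::
    "complex set \<Rightarrow> (complex \<Rightarrow> complex) \<Rightarrow> (complex \<Rightarrow> complex) \<Rightarrow> (complex \<Rightarrow> complex) \<Rightarrow> bool"
  where
  "normalized_lift U f \<pi> g \<longleftrightarrow>
     \<pi> holomorphic_on right_half_plane \<and> covering_space right_half_plane \<pi> U \<and>
     g holomorphic_on right_half_plane \<and> g ` right_half_plane \<subseteq> right_half_plane \<and>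
     (\<forall>z\<in>right_half_plane. \<pi> (g z) = f (\<pi> z)) \<and>
     iterates_tend_to_infinity right_half_plane g"

definition cowen_model ::
    "(complex \<Rightarrow> complex) \<Rightarrow> complex set \<Rightarrow> complex set \<Rightarrow> (complex \<Rightarrow> complex) \<Rightarrow>
     (complex \<Rightarrow> complex) \<Rightarrow> bool"
  where
  "cowen_model g V \<Omega> \<phi> T \<longleftrightarrow>
     \<Omega> \<in> {right_half_plane, UNIV} \<and>
     simply_connected V \<and> absorbing_domain V right_half_plane g \<and>
     \<phi> holomorphic_on right_half_plane \<and> \<phi> ` right_half_plane \<subseteq> \<Omega> \<and>
     moebius_onto_self \<Omega> T \<and>
     absorbing_domain (\<phi> ` V) \<Omega> T \<and>
     (\<forall>z\<in>right_half_plane. \<phi> (g z) = T (\<phi> z)) \<and>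
     inj_on \<phi> V"

text \<open>\<open>f\<close> has a Cowen model on \<open>\<Omega>\<close> whose Moebius map is conjugate, by a Moebius
  transformation preserving \<open>\<Omega>\<close>, to the normal form \<open>N\<close>.  The pair of \<open>\<Omega>\<close> and the class of
  \<open>N\<close> does not depend on the lift and the model, so the type is defined by the existence of one
  such choice.\<close>

definition has_cowen_type ::
    "complex set \<Rightarrow> (complex \<Rightarrow> complex) \<Rightarrow> complex set \<Rightarrow> (complex \<Rightarrow> complex) \<Rightarrow> bool" where
  "has_cowen_type U f \<Omega> N \<longleftrightarrow>
     (\<exists>\<pi> g V \<phi> T M. normalized_lift U f \<pi> g \<and> cowen_model g V \<Omega> \<phi> T \<and>
        moebius_onto_self \<Omega> M \<and> (\<forall>\<omega>\<in>\<Omega>. M (T \<omega>) = N (M \<omega>)))"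

definition parabolic_I_type :: "complex set \<Rightarrow> (complex \<Rightarrow> complex) \<Rightarrow> bool" where
  "parabolic_I_type U f \<longleftrightarrow> has_cowen_type U f UNIV (\<lambda>\<omega>. \<omega> + 1)"

end

theory Submission
  imports Defs
begin

text \<open>Let \<open>\<Phi>\<close> be the Cowen map, normalised so that it conjugates the lift \<open>g\<close> on \<open>V\<close> to
  \<open>\<omega> \<mapsto> \<omega> + 1\<close> on \<open>D = \<Phi> ` V\<close>, let \<open>\<psi>\<close> be the inverse of \<open>\<Phi>\<close> on \<open>V\<close>, and \<open>h = \<pi> \<circ> \<psi>\<close>, so that
  \<open>h (\<omega> + 1) = f (h \<omega>)\<close> on \<open>D\<close>.

  The key point is that \<open>h\<close> is injective. If \<open>h a = h b\<close> with \<open>a \<noteq> b\<close>, let \<open>\<Gamma>\<^sub>n\<close> be the deck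
  transformation that takes \<open>g\<^sup>n (\<psi> a)\<close> to \<open>g\<^sup>n (\<psi> b)\<close>. Since \<open>g \<circ> \<Gamma>\<^sub>n = \<Gamma>\<^sub>n\<^sub>+\<^sub>1 \<circ> g\<close>, the
  maps \<open>\<omega> \<mapsto> \<Phi> (\<Gamma>\<^sub>n (\<psi> (\<omega> + n))) - n\<close> fit together to an injective entire function without
  fixed points, which must be the translation by \<open>\<tau> = b - a\<close>. Hence \<open>h\<close> is \<open>\<tau>\<close>-periodic far to
  the right. For real \<open>\<tau>\<close> this is incompatible with \<open>h \<rightarrow> \<infinity>\<close>; otherwise \<open>h\<close> factors through
  \<open>exp (- 2 \<pi> \<i> \<omega> / \<tau>)\<close> there, and by the great Picard theorem the quotient map has a pole at
  \<open>0\<close>, so that \<open>U\<close> contains a punctured neighbourhood of \<open>\<infinity>\<close>.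

  The domain \<open>W\<close> is then the image under \<open>h\<close> of a convex region \<open>Re \<omega> > F (Im \<omega>)\<close> on which \<open>F\<close>
  grows so fast that \<open>h \<omega> \<rightarrow> \<infinity>\<close> as \<open>\<omega> \<rightarrow> \<infinity>\<close> in the closure of the region.\<close>

subsection \<open>Entire functions and isolated singularities\<close>

lemma injective_entire_affine:
  assumes hol: "G holomorphic_on UNIV" and inj: "inj G"
  obtains \<alpha> \<beta> where "\<And>z. G z = \<alpha> * z + \<beta>"
proof -
  \<comment> \<open>\<open>z / (G z - G 0)\<close> extends to a zero-free entire function of at most linear growth, so it is constant.\<close>
  define q where "q = (\<lambda>z. if z = 0 then deriv G 0 else (G z - G 0) / (z - 0))"
  have holq: "q holomorphic_on UNIV"
    unfolding q_def using pole_lemma_open [OF hol open_UNIV] .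
  have qnz: "q z \<noteq> 0" for z
    using holomorphic_injective_imp_regular [OF hol open_UNIV inj, of 0] inj
    by (simp add: q_def inj_eq)
  have "open (G ` ball 0 1)"
    using hol inj
    by (intro open_mapping_thm3) (meson holomorphic_on_subset inj_on_subset open_ball subset_UNIV)+
  then obtain e where e: "e > 0" "ball (G 0) e \<subseteq> G ` ball 0 1"
    by (meson centre_in_ball image_eqI openE zero_less_one)
  \<comment> \<open>Injectivity keeps the values taken outside the unit disc away from the image of
    the disc, and that image contains the ball of radius \<open>e\<close> about
    \<open>G 0\<close>.\<close>
  have far: "e \<le> norm (G z - G 0)" if "1 \<le> norm z" for z
  proof (rule ccontr)
    assume "\<not> e \<le> norm (G z - G 0)"
    then have "G z \<in> ball (G 0) e"
      by (simp add: dist_norm norm_minus_commute)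
    then have "z \<in> ball 0 1"
      using e inj by (metis imageE injD subsetD)
    then show False using that by simp
  qed
  have holr: "(\<lambda>z. inverse (q z)) holomorphic_on UNIV"
    by (intro holomorphic_intros holq qnz)
  have bd: "norm (inverse (q z)) \<le> (1 / e) * norm z ^ 1" if "1 \<le> norm z" for z
  proof -
    have "z \<noteq> 0" using that by auto
    then have "norm (inverse (q z)) = norm z / norm (G z - G 0)"
      by (simp add: q_def norm_divide norm_inverse)
    also have "\<dots> \<le> norm z / e"
      using far [OF that] \<open>e > 0\<close> that by (intro divide_left_mono mult_pos_pos) auto
    finally show ?thesis by simp
  qed
  define A B where "A = inverse (q 0)" and "B = deriv (\<lambda>z. inverse (q z)) 0"
  have lin: "inverse (q z) = A + B * z" for z
    using Liouville_polynomial [OF holr bd, where \<xi> = z] by (simp add: A_def B_def)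
  have "B = 0"
  proof (rule ccontr)
    assume "B \<noteq> 0"
    then have "inverse (q (- A / B)) = 0" by (simp add: lin)
    then show False using qnz by simp
  qed
  then have "q z = inverse A" for z
    using lin [of z] by (metis add.right_neutral inverse_inverse_eq mult_zero_left)
  then have qz: "q z = inverse A" for z .
  have "G z = inverse A * z + G 0" for z
  proof (cases "z = 0")
    case False
    then show ?thesis using qz [of z] by (simp add: q_def divide_eq_eq diff_eq_eq)
  qed simp
  then show thesis by (rule that)
qed

text \<open>Two omitted values rule out an essential singularity at \<open>0\<close>, and the
  sequence \<open>u\<close> rules out a finite limit. What remains is a pole, near which the
  reciprocal is an open map with a zero.\<close>

lemma great_Picard_image_neighbourhood_infinity:
  assumes "r > 0" and hol: "P holomorphic_on ball 0 r - {0}"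
    and "a \<noteq> b" and omit: "\<And>u. u \<in> ball 0 r - {0} \<Longrightarrow> P u \<noteq> a \<and> P u \<noteq> b"
    and u: "u \<longlonglongrightarrow> 0" "\<And>n. u n \<noteq> 0" and Pu: "filterlim (P \<circ> u) at_infinity sequentially"
  obtains R where "\<And>w. R < norm w \<Longrightarrow> w \<in> P ` (ball 0 r - {0})"
proof -
  \<comment> \<open>Subtracting \<open>a\<close> makes the function zero-free, so its reciprocal is
    holomorphic on the punctured disc.\<close>
  define p where "p = (\<lambda>x. P x - a)"
  have holp: "p holomorphic_on ball 0 r - {0}"
    unfolding p_def by (intro holomorphic_intros hol)
  have pnz: "p x \<noteq> 0 \<and> p x \<noteq> b - a" if "x \<in> ball 0 r - {0}" for x
    using omit [OF that] by (simp add: p_def)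
  have pu: "filterlim (p \<circ> u) at_infinity sequentially"
    using tendsto_add_filterlim_at_infinity [OF tendsto_const [of "- a"] Pu] by (simp add: p_def o_def)
  have u0: "filterlim u (at 0) sequentially"
    using u by (simp add: filterlim_at)
  obtain l where l: "(p \<longlongrightarrow> l) (at 0) \<or> ((inverse \<circ> p) \<longlongrightarrow> l) (at 0)"
  proof (rule great_Picard [OF open_ball _ _ holp pnz])
    show "(0::complex) \<in> ball 0 r" "0 \<noteq> b - a" using \<open>r > 0\<close> \<open>a \<noteq> b\<close> by auto
  qed
  have "\<not> (p \<longlongrightarrow> l) (at 0)"
  proof
    assume "(p \<longlongrightarrow> l) (at 0)"
    then have "(p \<circ> u) \<longlonglongrightarrow> l"
      using filterlim_compose [OF _ u0] by (simp add: o_def)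
    then show False
      using pu not_tendsto_and_filterlim_at_infinity sequentially_bot by blast
  qed
  with l have li: "((inverse \<circ> p) \<longlongrightarrow> l) (at 0)" by simp
  have "(\<lambda>n. inverse ((p \<circ> u) n)) \<longlonglongrightarrow> 0"
    using filterlim_compose [OF tendsto_inverse_0 pu] .
  moreover have "(\<lambda>n. inverse ((p \<circ> u) n)) \<longlonglongrightarrow> l"
    using filterlim_compose [OF li u0] by (simp add: o_def)
  ultimately have "l = 0" using LIMSEQ_unique by blast
  define Q where "Q = (\<lambda>x. if x = 0 then 0 else (inverse \<circ> p) x)"
  have holQ: "Q holomorphic_on ball 0 r"
    unfolding Q_def
  proof (rule removable_singularity)
    show "inverse \<circ> p holomorphic_on ball 0 r - {0}"
      unfolding o_def using pnz by (intro holomorphic_intros holp) auto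
  qed (use li \<open>l = 0\<close> in \<open>simp_all add: o_def\<close>)
  have "\<not> Q constant_on ball 0 r"
  proof
    assume "Q constant_on ball 0 r"
    then obtain c where c: "\<And>x. x \<in> ball 0 r \<Longrightarrow> Q x = c" by (auto simp: constant_on_def)
    have "Q 0 = 0" "Q (of_real (r/2)) \<noteq> 0"
      using \<open>r > 0\<close> pnz [of "of_real (r/2)"] by (auto simp: Q_def)
    then show False using c [of 0] c [of "of_real (r/2)"] \<open>r > 0\<close> by auto
  qed
  then have "open (Q ` ball 0 r)"
    using holQ by (intro open_mapping_thm [of Q "ball 0 r"]) auto
  moreover have "0 \<in> Q ` ball 0 r"
    using \<open>r > 0\<close> by (auto simp: Q_def image_iff intro!: bexI [of _ 0])
  ultimately obtain e where e: "e > 0" "ball 0 e \<subseteq> Q ` ball 0 r"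
    by (meson openE)
  \<comment> \<open>The bound makes \<open>w - a\<close> larger than \<open>1 / e\<close> in
    modulus, so its reciprocal lies in the ball covered by \<open>Q\<close>. Its preimage is not
    \<open>0\<close>, because \<open>Q\<close> vanishes there.\<close>
  have "w \<in> P ` (ball 0 r - {0})" if w: "1 / e + norm a < norm w" for w
  proof -
    have "1 / e < norm (w - a)"
      using w norm_triangle_ineq2 [of w a] by linarith
    moreover from this have "norm (w - a) > 0"
      using \<open>e > 0\<close> by (meson divide_pos_pos less_trans zero_less_one)
    ultimately have "inverse (w - a) \<in> ball 0 e" and "w \<noteq> a"
      using \<open>e > 0\<close> by (auto simp: norm_inverse norm_divide field_simps)
    then obtain x where x: "x \<in> ball 0 r" "Q x = inverse (w - a)" using e by force
    then have "x \<noteq> 0" using \<open>w \<noteq> a\<close> by (auto simp: Q_def)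
    then have "P x = w" using x by (auto simp: Q_def p_def)
    then show ?thesis using x \<open>x \<noteq> 0\<close> by force
  qed
  then show thesis by (rule that)
qed

section \<open>Convex functions of arbitrarily fast growth\<close>

lemma convex_majorant:
  fixes N :: "nat \<Rightarrow> real"
  obtains F :: "real \<Rightarrow> real" where "continuous_on UNIV F" "convex_on UNIV F"
    "\<And>y. 0 \<le> F y" "\<And>y. \<exists>k. \<bar>y\<bar> \<le> real k \<and> N k \<le> F y"
proof -
  \<comment> \<open>If \<open>k = \<lceil>\<bar>y\<bar>\<rceil> \<ge> 2\<close> then \<open>\<bar>y\<bar> > k - 1\<close>, so the summand with \<open>j = k - 2\<close> is at least \<open>\<bar>N k\<bar>\<close>.\<close>
  define G where "G = (\<lambda>m y. \<bar>N 0\<bar> + \<bar>N 1\<bar> + (\<Sum>j\<le>m. \<bar>N (j + 2)\<bar> * max 0 (\<bar>y\<bar> - real j)))"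
  define F where "F = (\<lambda>y. G (nat \<lceil>\<bar>y\<bar>\<rceil>) y)"
  \<comment> \<open>Summands with \<open>j \<ge> \<bar>y\<bar>\<close> vanish, so the upper limit of
    summation may be raised freely. On every bounded interval \<open>F\<close> thus coincides with
    one fixed \<open>G m\<close>, from which it inherits continuity and convexity.\<close>
  have GF: "F y = G m y" if "\<bar>y\<bar> \<le> real m" for y m
  proof -
    have le: "nat \<lceil>\<bar>y\<bar>\<rceil> \<le> m" using that by (simp add: ceiling_le_iff nat_le_iff)
    have "(\<Sum>j\<le>nat \<lceil>\<bar>y\<bar>\<rceil>. \<bar>N (j + 2)\<bar> * max 0 (\<bar>y\<bar> - real j))
        = (\<Sum>j\<le>m. \<bar>N (j + 2)\<bar> * max 0 (\<bar>y\<bar> - real j))"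
    proof (rule sum.mono_neutral_left)
      show "\<forall>i\<in>{..m} - {..nat \<lceil>\<bar>y\<bar>\<rceil>}. \<bar>N (i + 2)\<bar> * max 0 (\<bar>y\<bar> - real i) = 0"
      proof
        fix i assume "i \<in> {..m} - {..nat \<lceil>\<bar>y\<bar>\<rceil>}"
        then have "\<bar>y\<bar> \<le> real i" by simp linarith
        then show "\<bar>N (i + 2)\<bar> * max 0 (\<bar>y\<bar> - real i) = 0" by simp
      qed
    qed (use le in auto)
    then show ?thesis by (simp add: F_def G_def)
  qed
  have contG: "continuous_on S (G m)" for m S
    unfolding G_def by (intro continuous_intros)
  have abs_convex: "\<bar>(1-t) * x + t * y\<bar> \<le> (1-t) * \<bar>x\<bar> + t * \<bar>y\<bar>" if "0 \<le> t" "t \<le> 1" for t x y :: real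
    using abs_triangle_ineq [of "(1-t) * x" "t * y"] that by (simp add: abs_mult)
  have convG: "G m ((1-t) * x + t * y) \<le> (1-t) * G m x + t * G m y" if t: "0 \<le> t" "t \<le> 1" for m t x y
  proof -
    have one: "max 0 (\<bar>(1-t) * x + t * y\<bar> - c) \<le> (1-t) * max 0 (\<bar>x\<bar> - c) + t * max 0 (\<bar>y\<bar> - c)" for c
    proof -
      have "\<bar>(1-t) * x + t * y\<bar> - c \<le> (1-t) * (\<bar>x\<bar> - c) + t * (\<bar>y\<bar> - c)"
        using abs_convex [OF t, of x y] by (simp add: algebra_simps)
      also have "\<dots> \<le> (1-t) * max 0 (\<bar>x\<bar> - c) + t * max 0 (\<bar>y\<bar> - c)"
        using t by (intro add_mono mult_left_mono) auto
      finally show ?thesis using t by simp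
    qed
    have "(\<Sum>j\<le>m. \<bar>N (j + 2)\<bar> * max 0 (\<bar>(1-t) * x + t * y\<bar> - real j))
       \<le> (\<Sum>j\<le>m. \<bar>N (j + 2)\<bar> * ((1-t) * max 0 (\<bar>x\<bar> - real j) + t * max 0 (\<bar>y\<bar> - real j)))"
      by (intro sum_mono mult_left_mono one) auto
    also have "\<dots> = (1-t) * (\<Sum>j\<le>m. \<bar>N (j + 2)\<bar> * max 0 (\<bar>x\<bar> - real j))
        + t * (\<Sum>j\<le>m. \<bar>N (j + 2)\<bar> * max 0 (\<bar>y\<bar> - real j))"
      unfolding sum_distrib_left sum.distrib [symmetric] by (rule sum.cong) (auto simp: algebra_simps)
    finally show ?thesis by (simp add: G_def algebra_simps)
  qed
  show thesis
  proof (rule that)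
    show "continuous_on UNIV F"
    proof (rule continuous_at_imp_continuous_on, rule ballI)
      fix y :: real
      \<comment> \<open>The extra \<open>1\<close> keeps the unit ball about \<open>y\<close> inside
        the range where \<open>G m\<close> represents \<open>F\<close>.\<close>
      define m where "m = nat \<lceil>\<bar>y\<bar>\<rceil> + 1"
      have "continuous (at y) (G m)"
        using contG [of UNIV m] by (simp add: continuous_on_eq_continuous_at)
      moreover have "\<forall>\<^sub>F x in nhds y. F x = G m x"
      proof (rule eventually_mono [OF eventually_nhds_in_open])
        show "open (ball y 1)" "y \<in> ball y 1" by auto
        show "F x = G m x" if "x \<in> ball y 1" for x
          using that by (intro GF) (simp add: dist_real_def m_def, linarith)
      qed
      ultimately show "continuous (at y) F" by (simp add: isCont_cong)
    qed
    show "convex_on UNIV F"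
    proof (rule convex_onI)
      fix t x y :: real assume t: "0 < t" "t < 1"
      define m where "m = nat \<lceil>max \<bar>x\<bar> \<bar>y\<bar>\<rceil>"
      have x: "\<bar>x\<bar> \<le> real m" and y: "\<bar>y\<bar> \<le> real m" unfolding m_def by linarith+
      have "\<bar>(1-t) * x + t * y\<bar> \<le> (1-t) * real m + t * real m"
        using abs_convex [of t x y] t x y mult_left_mono [of "\<bar>x\<bar>" "real m" "1-t"] mult_left_mono [of "\<bar>y\<bar>" "real m" t]
        by linarith
      then have "\<bar>(1-t) * x + t * y\<bar> \<le> real m" by (simp add: algebra_simps)
      then show "F ((1 - t) *\<^sub>R x + t *\<^sub>R y) \<le> (1 - t) * F x + t * F y"
        using convG [of t m x y] t GF x y by simp
    qed simp
    show "0 \<le> F y" for y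
      unfolding F_def G_def by (intro add_nonneg_nonneg sum_nonneg) auto
    show "\<exists>k. \<bar>y\<bar> \<le> real k \<and> N k \<le> F y" for y
    proof (intro exI conjI)
      define k where "k = nat \<lceil>\<bar>y\<bar>\<rceil>"
      let ?s = "\<lambda>j. \<bar>N (j + 2)\<bar> * max 0 (\<bar>y\<bar> - real j)"
      show yk: "\<bar>y\<bar> \<le> real k" unfolding k_def by linarith
      have F: "F y = \<bar>N 0\<bar> + \<bar>N 1\<bar> + (\<Sum>j\<le>k. ?s j)" by (simp add: F_def G_def k_def)
      have sum0: "0 \<le> (\<Sum>j\<le>k. ?s j)" by (intro sum_nonneg) simp
      show "N k \<le> F y"
      proof (cases "k < 2")
        case True
        then have "k = 0 \<or> k = 1" by auto
        then have "N k \<le> \<bar>N 0\<bar> + \<bar>N 1\<bar>" by auto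
        then show ?thesis using F sum0 by linarith
      next
        case False
        then have "k = (k - 2) + 2" by simp
        then obtain j where k: "k = j + 2" by blast
        have "1 \<le> \<bar>y\<bar> - real j" using k unfolding k_def by linarith
        then have "\<bar>N (j + 2)\<bar> * 1 \<le> ?s j" by (intro mult_left_mono) auto
        also have "\<dots> \<le> (\<Sum>j\<le>k. ?s j)" using k by (intro member_le_sum) auto
        finally have "\<bar>N k\<bar> \<le> (\<Sum>j\<le>k. ?s j)" using k by simp
        then show ?thesis using F by linarith
      qed
    qed
  qed
qed


section \<open>Functions that are periodic far to the right\<close>

text \<open>Periodicity starts at an abscissa that depends on the strip, so the quotient is formed
  on a single half-strip wider than one period. Its image under \<open>exp (c * \<omega>)\<close>
  already contains a punctured disc about \<open>0\<close>, where Picard's theorem applies.\<close>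

lemma periodic_near_infinity_image:
  assumes "open D" and hol: "h holomorphic_on D" and "a \<noteq> b"
    and omit: "\<And>\<omega>. \<omega> \<in> D \<Longrightarrow> h \<omega> \<noteq> a \<and> h \<omega> \<noteq> b"
    and \<tau>: "Im \<tau> > 0"
    and strip: "\<And>k. \<exists>N. \<forall>\<omega>. N \<le> Re \<omega> \<and> \<bar>Im \<omega>\<bar> \<le> k \<longrightarrow> \<omega> \<in> D \<and> h (\<omega> + \<tau>) = h \<omega>"
    and inf: "filterlim (\<lambda>n. h (of_nat n)) at_infinity sequentially"
  obtains R where "\<And>w. R < norm w \<Longrightarrow> w \<in> h ` D"
proof -
  obtain N0 where N0: "\<And>\<omega>. N0 \<le> Re \<omega> \<Longrightarrow> \<bar>Im \<omega>\<bar> \<le> 2 * Im \<tau> \<Longrightarrow> \<omega> \<in> D \<and> h (\<omega> + \<tau>) = h \<omega>"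
    using strip by blast
  define N where "N = max N0 0"
  have N: "\<omega> \<in> D" "h (\<omega> + \<tau>) = h \<omega>" if "N \<le> Re \<omega>" "\<bar>Im \<omega>\<bar> \<le> 2 * Im \<tau>" for \<omega>
    using N0 that by (auto simp: N_def)
  \<comment> \<open>An open half-strip that contains the part of the period strip
    \<open>0 \<le> Im \<omega> < Im \<tau>\<close> to the right of \<open>N\<close>.\<close>
  define S where "S = {\<omega>. N < Re \<omega> \<and> \<bar>Im \<omega>\<bar> < 2 * Im \<tau>}"
  have "open S"
    unfolding S_def by (intro open_Collect_conj open_Collect_less continuous_intros)
  have SD: "S \<subseteq> D" using N by (auto simp: S_def)
  have period: "h (\<omega> + of_nat j * \<tau>) = h \<omega>" if "\<omega> \<in> S" "\<omega> + of_nat j * \<tau> \<in> S" for \<omega> j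
    using that(2)
  proof (induction j)
    case (Suc j)
    \<comment> \<open>The point lies on the segment between two points of the convex set
      \<open>S\<close>. The sign of \<open>Re \<tau>\<close> decides which endpoint bounds its real
      part from below.\<close>
    have "\<omega> + of_nat j * \<tau> \<in> S"
    proof -
      have "0 \<le> real j * Im \<tau>" using \<tau> by simp
      then have "- (2 * Im \<tau>) < Im \<omega> + real j * Im \<tau>"
        using \<open>\<omega> \<in> S\<close> unfolding S_def mem_Collect_eq abs_less_iff by linarith
      moreover have "Im \<omega> + real j * Im \<tau> < 2 * Im \<tau>"
        using Suc.prems \<tau> by (simp add: S_def abs_less_iff algebra_simps)
      moreover have "N < Re \<omega> + real j * Re \<tau>"
      proof (cases "0 \<le> Re \<tau>")
        case True
        then have "0 \<le> real j * Re \<tau>" by simp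
        then show ?thesis using \<open>\<omega> \<in> S\<close> by (simp add: S_def)
      next
        case False
        then show ?thesis using Suc.prems by (simp add: S_def algebra_simps)
      qed
      ultimately show ?thesis
        by (simp add: S_def abs_less_iff)
    qed
    moreover from this have "h (\<omega> + of_nat j * \<tau> + \<tau>) = h (\<omega> + of_nat j * \<tau>)"
      by (intro N) (auto simp: S_def)
    ultimately show ?case using Suc.IH by (simp add: algebra_simps)
  qed simp
  have "\<tau> \<noteq> 0" using \<tau> by auto
  \<comment> \<open>With \<open>c * \<tau> = - 2 \<pi> \<i>\<close>, the periods of
    \<open>exp (c * \<omega>)\<close> are exactly the integer multiples of \<open>\<tau>\<close>.
    The minus sign gives \<open>Re c < 0\<close>, so that the right end of the strip is sent to
    \<open>0\<close>.\<close>
  define c where "c = - 2 * of_real pi * \<i> / \<tau>"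
  have "c \<noteq> 0" using \<open>\<tau> \<noteq> 0\<close> by (simp add: c_def)
  have Rec: "Re c < 0"
    using \<tau> \<open>\<tau> \<noteq> 0\<close> by (simp add: c_def Re_divide cmod_power2 [symmetric] divide_less_0_iff)
  have c\<tau>: "c * \<tau> = - 2 * of_real pi * \<i>" using \<open>\<tau> \<noteq> 0\<close> by (simp add: c_def)
  have same: "h \<omega>' = h \<omega>" if S: "\<omega> \<in> S" "\<omega>' \<in> S" and e: "exp (c * \<omega>) = exp (c * \<omega>')" for \<omega> \<omega>'
  proof -
    obtain n :: int where n: "c * \<omega> = c * \<omega>' + of_int (2 * n) * of_real pi * \<i>"
      using e exp_eq by auto
    have "c * (\<omega>' - \<omega>) = of_int n * (c * \<tau>)"
      unfolding c\<tau> using n by (simp add: algebra_simps)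
    then have "c * (\<omega>' - \<omega>) = c * (of_int n * \<tau>)" by (simp only: mult.left_commute)
    then have n: "\<omega>' = \<omega> + of_int n * \<tau>" using \<open>c \<noteq> 0\<close> by (simp add: diff_eq_eq add.commute)
    show ?thesis
    proof (cases "0 \<le> n")
      case True
      then show ?thesis using period [OF S(1), of "nat n"] n S by simp
    next
      case False
      then have "\<omega> = \<omega>' + of_nat (nat (- n)) * \<tau>" using n by simp
      then show ?thesis using period [OF S(2), of "nat (- n)"] S by simp
    qed
  qed
  \<comment> \<open>The logarithm of the modulus of \<open>exp (c * \<omega>)\<close> is
    \<open>Re c * Re \<omega> - Im c * Im \<omega>\<close>. If it is below \<open>ln r\<close> and
    \<open>0 \<le> Im \<omega> < Im \<tau>\<close>, then \<open>Re \<omega> > N\<close>.\<close>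
  define r where "r = exp (- (\<bar>Re c\<bar> * N + \<bar>Im c\<bar> * Im \<tau>))"
  have lift: "\<exists>\<omega>\<in>S. exp (c * \<omega>) = u" if "u \<in> ball 0 r - {0}" for u
  proof -
    \<comment> \<open>A logarithm of \<open>u\<close>, divided by \<open>c\<close> and moved by a
      multiple of \<open>\<tau>\<close> into the period strip.\<close>
    define \<omega> where "\<omega> = Ln u / c - of_int \<lfloor>Im (Ln u / c) / Im \<tau>\<rfloor> * \<tau>"
    have "exp (c * \<omega>) = exp (Ln u) * exp (- (of_int \<lfloor>Im (Ln u / c) / Im \<tau>\<rfloor> * (c * \<tau>)))"
      using \<open>c \<noteq> 0\<close> by (simp add: \<omega>_def algebra_simps flip: exp_add)
    also have "exp (- (of_int \<lfloor>Im (Ln u / c) / Im \<tau>\<rfloor> * (c * \<tau>))) = 1"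
      unfolding c\<tau> by (subst exp_eq_1) auto
    finally have u: "exp (c * \<omega>) = u" using that by simp
    have Im\<omega>: "Im \<omega> = Im \<tau> * frac (Im (Ln u / c) / Im \<tau>)"
      using \<tau> by (simp add: \<omega>_def frac_def field_simps)
    then have Im: "0 \<le> Im \<omega>" "Im \<omega> < Im \<tau>"
      using \<tau> by (auto simp: frac_lt_1)
    have "exp (Re (c * \<omega>)) < r" using that u by (metis DiffD1 dist_0_norm mem_ball norm_exp_eq_Re)
    then have "Re c * Re \<omega> - Im c * Im \<omega> < - (\<bar>Re c\<bar> * N + \<bar>Im c\<bar> * Im \<tau>)"
      by (simp add: r_def)
    then have "Re c * Re \<omega> - Im c * Im \<omega> < Re c * N - \<bar>Im c\<bar> * Im \<tau>"
      using Rec by simp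
    moreover have "Im c * Im \<omega> \<le> \<bar>Im c\<bar> * Im \<tau>"
      using Im by (intro mult_mono) auto
    ultimately have "Re c * Re \<omega> < Re c * N" using Rec by linarith
    then have "N < Re \<omega>" using Rec by (simp add: mult_less_cancel_left)
    then have "\<omega> \<in> S" using Im by (simp add: S_def)
    then show ?thesis using u by blast
  qed
  \<comment> \<open>By \<open>same\<close>, the value does not depend on the chosen
    preimage.\<close>
  define P where "P = (\<lambda>u. h (SOME \<omega>. \<omega> \<in> S \<and> exp (c * \<omega>) = u))"
  have P: "P (exp (c * \<omega>)) = h \<omega>" if "\<omega> \<in> S" for \<omega>
  proof -
    define \<omega>' where "\<omega>' = (SOME \<omega>'. \<omega>' \<in> S \<and> exp (c * \<omega>') = exp (c * \<omega>))"
    have "\<omega>' \<in> S \<and> exp (c * \<omega>') = exp (c * \<omega>)"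
      unfolding \<omega>'_def by (rule someI [of _ \<omega>]) (use that in simp)
    then show ?thesis
      using same [OF that, of \<omega>'] unfolding P_def \<omega>'_def [symmetric] by simp
  qed
  have PD: "P u \<in> h ` D" if u: "u \<in> ball 0 r - {0}" for u
  proof -
    obtain \<omega> where "\<omega> \<in> S" "exp (c * \<omega>) = u" using lift [OF u] by blast
    then show ?thesis using P [of \<omega>] SD by auto
  qed
  have holP: "P holomorphic_on ball 0 r - {0}"
    unfolding holomorphic_on_def
  proof (rule ballI, rule field_differentiable_at_within)
    fix u :: complex assume "u \<in> ball 0 r - {0}"
    then obtain \<omega>0 where \<omega>0: "\<omega>0 \<in> S" "exp (c * \<omega>0) = u" and "u \<noteq> 0" using lift by blast
    \<comment> \<open>A local inverse of \<open>exp (c * \<omega>)\<close> with value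
      \<open>\<omega>0\<close> at \<open>u\<close>. Dividing by \<open>u\<close> moves the argument
      of \<open>Ln\<close> close to \<open>1\<close>, away from the branch cut.\<close>
    define L where "L = (\<lambda>v. \<omega>0 + Ln (v / u) / c)"
    have expL: "exp (c * L v) = v" if "v \<noteq> 0" for v
    proof -
      have "c * L v = c * \<omega>0 + Ln (v / u)" using \<open>c \<noteq> 0\<close> by (simp add: L_def distrib_left)
      then show ?thesis using that \<open>u \<noteq> 0\<close> \<omega>0 by (simp add: exp_add)
    qed
    have Lfd: "L field_differentiable at u"
    proof -
      have "(L has_field_derivative (1 / u) / c) (at u)"
        unfolding L_def using \<open>c \<noteq> 0\<close> \<open>u \<noteq> 0\<close> by (auto intro!: derivative_eq_intros)
      then show ?thesis by (auto simp: field_differentiable_def)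
    qed
    have Lu: "L u = \<omega>0" using \<open>u \<noteq> 0\<close> by (simp add: L_def)
    have "h field_differentiable at (L u)"
      using holomorphic_on_imp_differentiable_at [OF hol \<open>open D\<close>] SD \<omega>0 Lu by auto
    then have "(h \<circ> L) field_differentiable at u"
      using Lfd by (rule field_differentiable_compose [rotated])
    moreover have ev: "\<forall>\<^sub>F v in nhds u. (h \<circ> L) v = P v"
    proof -
      have "isCont L u" using Lfd by (rule field_differentiable_imp_continuous_at)
      then have "\<forall>\<^sub>F v in nhds u. L v \<in> S"
        using topological_tendstoD [of L "\<omega>0" "at u" S] \<open>open S\<close> \<omega>0(1) Lu
        by (simp add: isCont_def eventually_nhds_conv_at)
      moreover have "\<forall>\<^sub>F v in nhds u. v \<noteq> 0" using \<open>u \<noteq> 0\<close> by (simp add: t1_space_nhds)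
      ultimately show ?thesis
      proof eventually_elim
        case (elim v)
        then show ?case using P [of "L v"] expL by simp
      qed
    qed
    ultimately show "P field_differentiable at u"
      unfolding field_differentiable_def using DERIV_cong_ev [OF refl ev refl] by simp
  qed
  define n0 where "n0 = nat \<lceil>N\<rceil> + 1"
  have nS: "of_nat (n + n0) \<in> S" for n
    using \<tau> unfolding S_def n0_def by simp linarith
  obtain R where "\<And>w. R < norm w \<Longrightarrow> w \<in> P ` (ball 0 r - {0})"
  proof (rule great_Picard_image_neighbourhood_infinity [OF _ holP \<open>a \<noteq> b\<close>])
    show "r > 0" by (simp add: r_def)
    show "P u \<noteq> a \<and> P u \<noteq> b" if "u \<in> ball 0 r - {0}" for u
      using PD [OF that] omit by (metis imageE)
    have "(\<lambda>n. exp c ^ (n + n0)) \<longlonglongrightarrow> 0"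
      using Rec by (intro LIMSEQ_ignore_initial_segment LIMSEQ_power_zero) simp
    then show "(\<lambda>n. exp (c * of_nat (n + n0))) \<longlonglongrightarrow> 0"
      by (simp add: exp_of_nat2_mult del: of_nat_add)
    have "filterlim (\<lambda>n. h (of_nat (n + n0))) at_infinity sequentially"
      using filterlim_compose [OF inf filterlim_add_const_nat_at_top] .
    then show "filterlim (P \<circ> (\<lambda>n. exp (c * of_nat (n + n0)))) at_infinity sequentially"
      using P nS by (simp add: o_def)
  qed auto
  then show thesis using PD by (intro that) blast
qed

subsection \<open>Deck transformations and the Cowen model\<close>

lemma right_half_plane_convex_open: "convex right_half_plane" "open right_half_plane"
  unfolding right_half_plane_def by (rule convex_halfspace_Re_gt, rule open_halfspace_Re_gt)

text \<open>Parabolic I type enters through \<open>absorb_D\<close>: compact subsets of the whole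
  plane, not only of a half-plane, are eventually translated into the image of
  \<open>V\<close>.\<close>

locale shift_model =
  fixes U :: "complex set" and f \<pi> g :: "complex \<Rightarrow> complex" and V :: "complex set"
    and \<Phi> :: "complex \<Rightarrow> complex"
  assumes to_inf: "iterates_tend_to_infinity U f"
    and hol_pi: "\<pi> holomorphic_on right_half_plane"
    and cov: "covering_space right_half_plane \<pi> U"
    and hol_g: "g holomorphic_on right_half_plane"
    and g_maps: "g ` right_half_plane \<subseteq> right_half_plane"
    and semi: "\<And>z. z \<in> right_half_plane \<Longrightarrow> \<pi> (g z) = f (\<pi> z)"
    and absorb_V: "absorbing_domain V right_half_plane g"
    and hol_Phi: "\<Phi> holomorphic_on right_half_plane"
    and Phi_g: "\<And>z. z \<in> right_half_plane \<Longrightarrow> \<Phi> (g z) = \<Phi> z + 1"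
    and inj_Phi: "inj_on \<Phi> V"
    and absorb_D: "\<And>K. compact K \<Longrightarrow> \<exists>n. \<forall>\<omega>\<in>K. \<omega> + of_nat n \<in> \<Phi> ` V"
begin

abbreviation H :: "complex set" where "H \<equiv> right_half_plane"

definition D :: "complex set" where "D = \<Phi> ` V"

definition \<psi> :: "complex \<Rightarrow> complex" where "\<psi> = the_inv_into V \<Phi>"

definition h :: "complex \<Rightarrow> complex" where "h = \<pi> \<circ> \<psi>"

lemma V: "open V" "V \<subseteq> H" "\<And>z. z \<in> V \<Longrightarrow> g z \<in> V"
  and absorbs_V: "\<And>K. compact K \<Longrightarrow> K \<subseteq> H \<Longrightarrow> \<exists>n. (g ^^ n) ` K \<subseteq> V"
  using absorb_V by (auto simp: absorbing_domain_def plane_domain_def)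

lemma iter_H: "z \<in> H \<Longrightarrow> (g ^^ n) z \<in> H"
  by (induction n) (use g_maps in auto)

lemma iter_V: "z \<in> V \<Longrightarrow> (g ^^ n) z \<in> V"
  by (induction n) (use V in auto)

lemma pi_iter: "z \<in> H \<Longrightarrow> \<pi> ((g ^^ n) z) = (f ^^ n) (\<pi> z)"
  by (induction n) (auto simp: semi iter_H)

lemma Phi_iter: "z \<in> H \<Longrightarrow> \<Phi> ((g ^^ n) z) = \<Phi> z + of_nat n"
  by (induction n) (auto simp: Phi_g iter_H)

lemma open_D: "open D"
  unfolding D_def
  using hol_Phi V inj_Phi by (meson holomorphic_on_subset open_mapping_thm3)

lemma psi_Phi: "z \<in> V \<Longrightarrow> \<psi> (\<Phi> z) = z"
  by (simp add: \<psi>_def the_inv_into_f_f [OF inj_Phi])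

lemma Phi_psi: "\<omega> \<in> D \<Longrightarrow> \<Phi> (\<psi> \<omega>) = \<omega>"
  and psi_V: "\<omega> \<in> D \<Longrightarrow> \<psi> \<omega> \<in> V"
  by (auto simp: D_def psi_Phi)

lemma psi_H: "\<omega> \<in> D \<Longrightarrow> \<psi> \<omega> \<in> H"
  using psi_V V by blast

lemma hol_psi: "\<psi> holomorphic_on D"
proof -
  obtain q where q: "q holomorphic_on \<Phi> ` V" "\<And>z. z \<in> V \<Longrightarrow> q (\<Phi> z) = z"
    using holomorphic_has_inverse [OF holomorphic_on_subset [OF hol_Phi V(2)] V(1) inj_Phi] by metis
  show ?thesis
    unfolding D_def by (rule holomorphic_transform [OF q(1)]) (auto simp: q psi_Phi)
qed

lemma D_shift: "\<omega> \<in> D \<Longrightarrow> \<omega> + of_nat n \<in> D"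
  and psi_shift: "\<omega> \<in> D \<Longrightarrow> \<psi> (\<omega> + of_nat n) = (g ^^ n) (\<psi> \<omega>)"
proof -
  assume "\<omega> \<in> D"
  then have "\<Phi> ((g ^^ n) (\<psi> \<omega>)) = \<omega> + of_nat n" "(g ^^ n) (\<psi> \<omega>) \<in> V"
    by (simp_all add: Phi_iter psi_H Phi_psi iter_V psi_V)
  then show "\<omega> + of_nat n \<in> D" "\<psi> (\<omega> + of_nat n) = (g ^^ n) (\<psi> \<omega>)"
    unfolding D_def by (metis imageI, metis psi_Phi)
qed

lemma hol_h: "h holomorphic_on D"
  unfolding h_def
  using hol_psi hol_pi psi_H by (intro holomorphic_on_compose_gen) auto

lemma h_U: "\<omega> \<in> D \<Longrightarrow> h \<omega> \<in> U"
  using covering_space_imp_surjective [OF cov] psi_H by (auto simp: h_def)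

lemma h_shift: "\<omega> \<in> D \<Longrightarrow> h (\<omega> + of_nat n) = (f ^^ n) (h \<omega>)"
  by (simp add: h_def psi_shift pi_iter psi_H)

lemma eventually_D:
  assumes "compact K" obtains n where "\<And>m \<omega>. m \<ge> n \<Longrightarrow> \<omega> \<in> K \<Longrightarrow> \<omega> + of_nat m \<in> D"
proof -
  obtain n where n: "\<And>\<omega>. \<omega> \<in> K \<Longrightarrow> \<omega> + of_nat n \<in> D"
    using absorb_D [OF assms] by (auto simp: D_def)
  have "\<omega> + of_nat m \<in> D" if "m \<ge> n" "\<omega> \<in> K" for m \<omega>
    using D_shift [OF n [OF that(2)], of "m - n"] that(1) by (simp add: of_nat_diff)
  then show thesis by (rule that)
qed

text \<open>Some translate of \<open>K\<close> lies in \<open>D\<close> and has a compact image in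
  \<open>U\<close>. From there on, translating by \<open>1\<close> amounts to applying
  \<open>f\<close>, whose iterates tend to infinity on that image.\<close>

lemma h_to_infinity:
  assumes "compact K"
  shows "\<exists>n. \<forall>m\<ge>n. \<forall>\<omega>\<in>K. \<omega> + of_nat m \<in> D \<and> R < norm (h (\<omega> + of_nat m))"
proof -
  obtain n where n: "\<And>m \<omega>. m \<ge> n \<Longrightarrow> \<omega> \<in> K \<Longrightarrow> \<omega> + of_nat m \<in> D"
    using eventually_D [OF assms] by blast
  define L where "L = (\<lambda>\<omega>. h (\<omega> + of_nat n)) ` K"
  have "compact L"
    unfolding L_def
    using n hol_h assms
    by (intro compact_continuous_image continuous_on_compose2 [OF holomorphic_on_imp_continuous_on [OF hol_h]]
          continuous_intros) auto
  moreover have "L \<subseteq> U" using n h_U by (auto simp: L_def)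
  ultimately obtain k where k: "\<And>j z. j \<ge> k \<Longrightarrow> z \<in> L \<Longrightarrow> R < norm ((f ^^ j) z)"
    using to_inf unfolding iterates_tend_to_infinity_def eventually_sequentially by meson
  show ?thesis
  proof (intro exI allI impI ballI conjI)
    fix m \<omega> assume m: "n + k \<le> m" "\<omega> \<in> K"
    then show "\<omega> + of_nat m \<in> D" using n by simp
    have "h (\<omega> + of_nat n + of_nat (m - n)) = (f ^^ (m - n)) (h (\<omega> + of_nat n))"
      using n m by (intro h_shift) auto
    moreover have "R < norm ((f ^^ (m - n)) (h (\<omega> + of_nat n)))"
      using m by (intro k) (auto simp: L_def)
    ultimately show "R < norm (h (\<omega> + of_nat m))" using m by (simp add: of_nat_diff)
  qed
qed

section \<open>Deck transformations of the covering\<close>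

text \<open>Only a continuous self-map over \<open>\<pi>\<close> is required: holomorphy and
  injectivity follow from the lifting properties of the covering.\<close>

definition deck :: "(complex \<Rightarrow> complex) \<Rightarrow> bool" where
  "deck \<Gamma> \<longleftrightarrow> continuous_on H \<Gamma> \<and> (\<forall>z\<in>H. \<Gamma> z \<in> H \<and> \<pi> (\<Gamma> z) = \<pi> z)"

lemma cont_pi: "continuous_on H \<pi>"
  by (rule holomorphic_on_imp_continuous_on [OF hol_pi])

lemma cont_g: "continuous_on H g"
  by (rule holomorphic_on_imp_continuous_on [OF hol_g])

lemma pi_maps: "\<pi> \<in> H \<rightarrow> U"
  using covering_space_imp_surjective [OF cov] by auto

lemma deck_holomorphic:
  assumes "deck \<Gamma>" shows "\<Gamma> holomorphic_on H"
  using assms pi_maps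
  by (intro covering_space_lift_is_holomorphic [OF cov right_half_plane_convex_open(2) hol_pi hol_pi])
     (auto simp: deck_def)

text \<open>Since the half-plane is simply connected, \<open>\<pi>\<close> lifts through itself with
  any prescribed value in the fibre.\<close>

lemma deck_exists:
  assumes "z \<in> H" "w \<in> H" "\<pi> z = \<pi> w"
  obtains \<Gamma> where "deck \<Gamma>" "\<Gamma> z = w"
proof -
  have "simply_connected H" "locally path_connected H"
    using right_half_plane_convex_open
    by (auto intro: convex_imp_simply_connected convex_imp_locally_path_connected)
  then obtain \<Gamma> where "continuous_on H \<Gamma>" "\<Gamma> \<in> H \<rightarrow> H" "\<Gamma> z = w" "\<And>y. y \<in> H \<Longrightarrow> \<pi> (\<Gamma> y) = \<pi> y"
    using covering_space_lift_strong [OF cov assms(2,1) _ _ cont_pi pi_maps assms(3)] by blast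
  then show thesis by (intro that [of \<Gamma>]) (auto simp: deck_def)
qed

lemma lift_eq:
  assumes "continuous_on H p" "continuous_on H q" "p \<in> H \<rightarrow> H" "q \<in> H \<rightarrow> H"
    and "\<And>x. x \<in> H \<Longrightarrow> \<pi> (p x) = \<pi> (q x)" and "z \<in> H" "p z = q z" and "x \<in> H"
  shows "p x = q x"
proof (rule covering_space_lift_unique [where ?g1.0 = p and ?g2.0 = q and f = "\<pi> \<circ> p" and T = H])
  show "continuous_on H (\<pi> \<circ> p)"
    using assms(1,3) by (intro continuous_on_compose continuous_on_subset [OF cont_pi]) auto
  show "\<pi> \<circ> p \<in> H \<rightarrow> U" using assms(3) pi_maps by auto
  show "connected H" using right_half_plane_convex_open(1) by (rule convex_connected)
qed (use assms cov in auto)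

lemma deck_eq:
  assumes "deck \<Gamma>" "deck \<Gamma>'" "z \<in> H" "\<Gamma> z = \<Gamma>' z" "x \<in> H"
  shows "\<Gamma> x = \<Gamma>' x"
  using assms by (intro lift_eq [of \<Gamma> \<Gamma>' z x]) (auto simp: deck_def)

lemma deck_id: "deck (\<lambda>z. z)"
  by (simp add: deck_def continuous_on_id)

text \<open>A deck map that sends \<open>\<Gamma> 1\<close> back to \<open>1\<close> is a left
  inverse, by uniqueness of lifts.\<close>

lemma deck_inj:
  assumes "deck \<Gamma>" shows "inj_on \<Gamma> H"
proof -
  have "1 \<in> H" by (simp add: right_half_plane_def)
  then obtain \<Gamma>' where \<Gamma>': "deck \<Gamma>'" "\<Gamma>' (\<Gamma> 1) = 1"
    using deck_exists [of "\<Gamma> 1" 1] assms by (auto simp: deck_def)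
  have "deck (\<lambda>z. \<Gamma>' (\<Gamma> z))"
    using assms \<Gamma>'(1) unfolding deck_def by (auto intro: continuous_on_compose2)
  then have "\<Gamma>' (\<Gamma> z) = z" if "z \<in> H" for z
    using deck_eq [of "\<lambda>z. \<Gamma>' (\<Gamma> z)" "\<lambda>z. z" 1 z] deck_id \<open>1 \<in> H\<close> \<Gamma>'(2) that by simp
  then show ?thesis by (rule inj_on_inverseI)
qed

text \<open>Both sides are lifts of \<open>f \<circ> \<pi>\<close>, so agreement at one point
  propagates to the whole half-plane.\<close>

lemma deck_g:
  assumes "deck \<Gamma>" "deck \<Gamma>'" "z \<in> H" "g (\<Gamma> z) = \<Gamma>' (g z)" "x \<in> H"
  shows "g (\<Gamma> x) = \<Gamma>' (g x)"
proof (rule lift_eq [where p = "\<lambda>x. g (\<Gamma> x)" and q = "\<lambda>x. \<Gamma>' (g x)" and z = z])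
  show "continuous_on H (\<lambda>x. g (\<Gamma> x))" "continuous_on H (\<lambda>x. \<Gamma>' (g x))"
    using assms(1,2) g_maps
    by (auto simp: deck_def intro: continuous_on_compose2 [OF cont_g] continuous_on_compose2 [OF _ cont_g])
  show "\<pi> (g (\<Gamma> x)) = \<pi> (\<Gamma>' (g x))" if "x \<in> H" for x
  proof -
    have "\<pi> (g (\<Gamma> x)) = f (\<pi> x)" using that assms(1) by (simp add: semi deck_def)
    moreover have "\<pi> (\<Gamma>' (g x)) = f (\<pi> x)" 
      using that assms(2) g_maps by (simp add: semi deck_def image_subset_iff)
    ultimately show ?thesis by simp
  qed
qed (use assms g_maps in \<open>auto simp: deck_def\<close>)

section \<open>From collisions of \<open>h\<close> to periods\<close>

lemma collision_period:
  assumes ab: "a \<in> D" "b \<in> D" "a \<noteq> b" "h a = h b" and K: "compact K"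
  shows "\<exists>n. \<forall>m\<ge>n. \<forall>\<omega>\<in>K. h (\<omega> + of_nat m + (b - a)) = h (\<omega> + of_nat m)"
proof -
  have "\<exists>\<Gamma>. deck \<Gamma> \<and> \<Gamma> ((g ^^ n) (\<psi> a)) = (g ^^ n) (\<psi> b)" for n
    using deck_exists [of "(g ^^ n) (\<psi> a)" "(g ^^ n) (\<psi> b)"] ab
    by (metis comp_apply h_def iter_H pi_iter psi_H)
  then obtain \<Gamma> where deck: "\<And>n. deck (\<Gamma> n)" 
    and \<Gamma>: "\<And>n. \<Gamma> n ((g ^^ n) (\<psi> a)) = (g ^^ n) (\<psi> b)" by metis
  have \<Gamma>_H: "\<Gamma> n z \<in> H" "\<pi> (\<Gamma> n z) = \<pi> z" if "z \<in> H" for n z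
    using deck [of n] that by (auto simp: deck_def)
  have \<Gamma>_g: "g (\<Gamma> n z) = \<Gamma> (Suc n) (g z)" if "z \<in> H" for n z
    using deck_g [OF deck deck iter_H [OF psi_H [OF ab(1)]] _ that, of n n "Suc n"]
      \<Gamma> [of n] \<Gamma> [of "Suc n"] by simp
  have \<Gamma>_iter: "(g ^^ m) (\<Gamma> n z) = \<Gamma> (n + m) ((g ^^ m) z)" if "z \<in> H" for n m z
    by (induction m) (auto simp: \<Gamma>_g iter_H that)
  \<comment> \<open>\<open>\<Gamma> n\<close> in the coordinate \<open>\<Phi>\<close>, conjugated by
    the translation by \<open>n\<close>; this is meaningful where \<open>\<omega> + n\<close> lies
    in \<open>D\<close>.\<close>
  define A where "A = (\<lambda>n \<omega>. \<Phi> (\<Gamma> n (\<psi> (\<omega> + of_nat n))) - of_nat n)"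
  have A_add: "A (n + m) \<omega> = A n \<omega>" if "\<omega> + of_nat n \<in> D" for n m \<omega>
  proof -
    have "\<Gamma> (n + m) (\<psi> (\<omega> + of_nat n + of_nat m)) = (g ^^ m) (\<Gamma> n (\<psi> (\<omega> + of_nat n)))"
      using that by (simp add: psi_shift \<Gamma>_iter psi_H)
    then show ?thesis
      using that by (simp add: A_def Phi_iter \<Gamma>_H psi_H add.assoc)
  qed
  \<comment> \<open>Two admissible indices \<open>n\<close> and \<open>k\<close> give the same
    value, since both agree with index \<open>n + k\<close>.\<close>
  define G where "G = (\<lambda>\<omega>. A (SOME n. \<omega> + of_nat n \<in> D) \<omega>)"
  have G: "G \<omega> = A n \<omega>" if "\<omega> + of_nat n \<in> D" for n \<omega>
  proof -
    define k where "k = (SOME n. \<omega> + of_nat n \<in> D)"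
    have k: "\<omega> + of_nat k \<in> D" unfolding k_def by (rule someI [where x = n]) (rule that)
    have "A n \<omega> = A (n + k) \<omega>" "A k \<omega> = A (k + n) \<omega>"
      using A_add that k by simp_all
    then show ?thesis by (simp add: G_def k_def [symmetric] add.commute)
  qed
  have ex_D: "\<exists>n. \<omega> + of_nat n \<in> D" for \<omega>
    using eventually_D [of "{\<omega>}"] by (metis compact_sing order_refl singletonI)
  have "G holomorphic_on (\<Union>n\<in>UNIV. {\<omega>. \<omega> + of_nat n \<in> D})"
  proof (rule holomorphic_on_UN_open)
    fix n :: nat
    show "open {\<omega>. \<omega> + of_nat n \<in> D}"
      using open_vimage [OF open_D, of "\<lambda>\<omega>. \<omega> + of_nat n"]
      by (simp add: vimage_def continuous_on_add)
    have "(\<lambda>\<omega>. \<psi> (\<omega> + of_nat n)) holomorphic_on {\<omega>. \<omega> + of_nat n \<in> D}"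
      by (rule holomorphic_on_compose_gen [OF _ hol_psi, unfolded o_def]) (auto intro!: holomorphic_intros)
    then have "(\<lambda>\<omega>. \<Gamma> n (\<psi> (\<omega> + of_nat n))) holomorphic_on {\<omega>. \<omega> + of_nat n \<in> D}"
      by (rule holomorphic_on_compose_gen [OF _ deck_holomorphic [OF deck], unfolded o_def]) (auto simp: psi_H)
    then have "(\<lambda>\<omega>. \<Phi> (\<Gamma> n (\<psi> (\<omega> + of_nat n)))) holomorphic_on {\<omega>. \<omega> + of_nat n \<in> D}"
      by (rule holomorphic_on_compose_gen [OF _ hol_Phi, unfolded o_def]) (auto simp: psi_H \<Gamma>_H)
    then have "A n holomorphic_on {\<omega>. \<omega> + of_nat n \<in> D}"
      unfolding A_def by (intro holomorphic_intros)
    then show "G holomorphic_on {\<omega>. \<omega> + of_nat n \<in> D}"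
      by (rule holomorphic_transform) (auto simp: G)
  qed
  moreover have "(\<Union>n\<in>UNIV. {\<omega>. \<omega> + of_nat n \<in> D}) = UNIV" using ex_D by auto
  ultimately have holG: "G holomorphic_on UNIV" by simp
  \<comment> \<open>Injectivity of \<open>\<Phi>\<close> is available only on \<open>V\<close>, so
    \<open>G \<omega> + m\<close> determines the point
    \<open>\<Gamma> m (\<psi> (\<omega> + m))\<close> once that point lies in \<open>V\<close>.
    Absorption by \<open>V\<close> achieves this for all large \<open>m\<close>, uniformly on
    \<open>L\<close>.\<close>
  have land: "\<exists>N. \<forall>m\<ge>N. \<forall>\<omega>\<in>L. \<omega> + of_nat m \<in> D \<and> \<Gamma> m (\<psi> (\<omega> + of_nat m)) = \<psi> (G \<omega> + of_nat m)"
    if L: "compact L" for L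
  proof -
    obtain n where n: "\<And>m \<omega>. m \<ge> n \<Longrightarrow> \<omega> \<in> L \<Longrightarrow> \<omega> + of_nat m \<in> D"
      using eventually_D [OF L] by blast
    define X where "X = (\<lambda>\<omega>. \<Gamma> n (\<psi> (\<omega> + of_nat n))) ` L"
    have "continuous_on L (\<lambda>\<omega>. \<psi> (\<omega> + of_nat n))"
      using n by (intro continuous_on_compose2 [OF holomorphic_on_imp_continuous_on [OF hol_psi]]
          continuous_intros) auto
    then have "continuous_on L (\<lambda>\<omega>. \<Gamma> n (\<psi> (\<omega> + of_nat n)))"
      using n deck [of n] by (auto simp: deck_def psi_H intro: continuous_on_compose2)
    then have "compact X" unfolding X_def using L by (rule compact_continuous_image)
    moreover have "X \<subseteq> H" using n by (auto simp: X_def \<Gamma>_H psi_H)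
    ultimately obtain k where k: "(g ^^ k) ` X \<subseteq> V" using absorbs_V by blast
    show ?thesis
    proof (intro exI allI impI ballI)
      fix m \<omega> assume m: "n + k \<le> m" and \<omega>: "\<omega> \<in> L"
      define j where "j = m - n - k"
      have m_eq: "m = n + (j + k)" using m by (simp add: j_def)
      have \<omega>n: "\<omega> + of_nat n \<in> D" and \<omega>m: "\<omega> + of_nat m \<in> D" using n \<omega> m by auto
      have "\<Gamma> m (\<psi> (\<omega> + of_nat m)) = \<Gamma> (n + (j + k)) (\<psi> (\<omega> + of_nat n + of_nat (j + k)))"
        by (simp add: m_eq add.assoc)
      also have "\<dots> = (g ^^ (j + k)) (\<Gamma> n (\<psi> (\<omega> + of_nat n)))"
        using \<omega>n by (simp only: psi_shift \<Gamma>_iter psi_H)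
      also have "\<dots> = (g ^^ j) ((g ^^ k) (\<Gamma> n (\<psi> (\<omega> + of_nat n))))"
        by (simp add: funpow_add)
      also have "\<dots> \<in> V" using k \<omega> by (intro iter_V [of _ j]) (auto simp: X_def)
      finally have in_V: "\<Gamma> m (\<psi> (\<omega> + of_nat m)) \<in> V" .
      have "\<Phi> (\<Gamma> m (\<psi> (\<omega> + of_nat m))) = G \<omega> + of_nat m"
        using G [OF \<omega>m] by (simp add: A_def)
      then show "\<omega> + of_nat m \<in> D \<and> \<Gamma> m (\<psi> (\<omega> + of_nat m)) = \<psi> (G \<omega> + of_nat m)"
        using \<omega>m psi_Phi [OF in_V] by simp
    qed
  qed
  have "inj G"
  proof (rule injI)
    fix x y assume "G x = G y"
    obtain m where "\<forall>\<omega>\<in>{x, y}. \<omega> + of_nat m \<in> D \<and> \<Gamma> m (\<psi> (\<omega> + of_nat m)) = \<psi> (G \<omega> + of_nat m)"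
      using land [of "{x, y}"] by (metis finite.emptyI finite.insertI finite_imp_compact order_refl)
    then have m: "x + of_nat m \<in> D" "y + of_nat m \<in> D" 
      "\<Gamma> m (\<psi> (x + of_nat m)) = \<Gamma> m (\<psi> (y + of_nat m))"
      using \<open>G x = G y\<close> by auto
    then have "\<psi> (x + of_nat m) = \<psi> (y + of_nat m)"
      using deck_inj [OF deck, of m] psi_H by (auto dest: inj_onD)
    then show "x = y" using m Phi_psi by (metis add_right_cancel)
  qed
  then obtain \<alpha> \<beta> where affine: "\<And>z. G z = \<alpha> * z + \<beta>"
    using injective_entire_affine [OF holG] by blast
  \<comment> \<open>A fixed point of \<open>G\<close> yields one of some \<open>\<Gamma> m\<close>,
    which is then the identity. But \<open>\<Gamma> m\<close> moves a point with coordinate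
    \<open>a + m\<close> to one with coordinate \<open>b + m\<close>.\<close>
  have no_fix: "G \<omega> \<noteq> \<omega>" for \<omega>
  proof
    assume "G \<omega> = \<omega>"
    obtain m where m: "\<omega> + of_nat m \<in> D" "\<Gamma> m (\<psi> (\<omega> + of_nat m)) = \<psi> (\<omega> + of_nat m)"
      using land [of "{\<omega>}"] \<open>G \<omega> = \<omega>\<close> by (metis compact_sing order_refl singletonI)
    then have "\<Gamma> m ((g ^^ m) (\<psi> a)) = (g ^^ m) (\<psi> a)"
      using deck_eq [of "\<Gamma> m" "\<lambda>z. z" "\<psi> (\<omega> + of_nat m)" "(g ^^ m) (\<psi> a)"] deck [of m] deck_id
        psi_H [OF m(1)] iter_H [OF psi_H [OF ab(1)]] by simp
    then have "\<psi> (b + of_nat m) = \<psi> (a + of_nat m)" using ab \<Gamma> by (simp add: psi_shift)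
    then have "b + of_nat m = a + of_nat m" using ab D_shift Phi_psi by metis
    then show False using ab(3) by simp
  qed
  have "\<alpha> = 1"
  proof (rule ccontr)
    assume "\<alpha> \<noteq> 1"
    then have "G (\<beta> / (1 - \<alpha>)) = \<beta> / (1 - \<alpha>)" by (simp add: affine field_simps)
    then show False using no_fix by blast
  qed
  \<comment> \<open>Index \<open>0\<close> is admissible because \<open>a\<close> itself lies in
    \<open>D\<close>.\<close>
  moreover have "G a = b" using G [of a 0] ab \<Gamma> [of 0] by (simp add: A_def Phi_psi)
  ultimately have G_eq: "G \<omega> = \<omega> + (b - a)" for \<omega>
    using affine [of \<omega>] affine [of a] by (simp add: algebra_simps)
  obtain N where N: "\<And>m \<omega>. m \<ge> N \<Longrightarrow> \<omega> \<in> K \<Longrightarrow>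
      \<omega> + of_nat m \<in> D \<and> \<Gamma> m (\<psi> (\<omega> + of_nat m)) = \<psi> (G \<omega> + of_nat m)"
    using land [OF K] by blast
  show ?thesis
  proof (intro exI allI impI ballI)
    fix m \<omega> assume "N \<le> m" "\<omega> \<in> K"
    then have *: "\<omega> + of_nat m \<in> D" "\<Gamma> m (\<psi> (\<omega> + of_nat m)) = \<psi> (G \<omega> + of_nat m)" using N by auto
    have "h (\<omega> + of_nat m + (b - a)) = \<pi> (\<psi> (G \<omega> + of_nat m))"
      by (simp add: h_def G_eq algebra_simps)
    also have "\<dots> = h (\<omega> + of_nat m)"
      using \<Gamma>_H(2) [OF psi_H [OF *(1)], of m] *(2) by (simp add: h_def)
    finally show "h (\<omega> + of_nat m + (b - a)) = h (\<omega> + of_nat m)" .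
  qed
qed

end

section \<open>Half-strips, compact lifts and the point at infinity\<close>

text \<open>Integer translates of one rectangle of width \<open>1\<close> cover the half-strip, so
  uniformity on compact sets yields a bound for the whole end of it.\<close>

lemma half_strip:
  assumes "\<And>K. compact K \<Longrightarrow> \<exists>n. \<forall>m\<ge>n. \<forall>\<omega>\<in>K. Q (\<omega> + of_nat m)"
  shows "\<exists>N. \<forall>\<omega>. N \<le> Re \<omega> \<and> \<bar>Im \<omega>\<bar> \<le> k \<longrightarrow> Q \<omega>"
proof -
  define K where "K = cbox (Complex 0 (- k)) (Complex 1 k)"
  obtain n where n: "\<And>m \<omega>. m \<ge> n \<Longrightarrow> \<omega> \<in> K \<Longrightarrow> Q (\<omega> + of_nat m)"
    using assms [of K] by (auto simp: K_def)
  have "Q \<omega>" if "real n \<le> Re \<omega>" "\<bar>Im \<omega>\<bar> \<le> k" for \<omega>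
  proof -
    define m where "m = nat \<lfloor>Re \<omega>\<rfloor>"
    have m: "real m \<le> Re \<omega>" "Re \<omega> \<le> 1 + real m" "n \<le> m"
      using that(1) unfolding m_def by linarith+
    then have "\<omega> - of_nat m \<in> K"
      using that(2) by (auto simp: K_def in_cbox_complex_iff)
    then show ?thesis using n [OF m(3), of "\<omega> - of_nat m"] by simp
  qed
  then show ?thesis by blast
qed

text \<open>Covering maps are open, so \<open>K\<close> is covered by the images of finitely many
  small balls, whose closures lie in \<open>C\<close>.\<close>

lemma covering_space_compact_lift:
  fixes p :: "'a::euclidean_space \<Rightarrow> 'b::euclidean_space"
  assumes cov: "covering_space C p S" and "open C" "open S" and K: "compact K" "K \<subseteq> S"
  obtains L where "compact L" "L \<subseteq> C" "K \<subseteq> p ` L"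
proof -
  have "\<exists>z r. 0 < r \<and> cball z r \<subseteq> C \<and> p z = x" if x: "x \<in> K" for x
  proof -
    obtain z where "z \<in> C" "p z = x"
      using x K(2) covering_space_imp_surjective [OF cov] by blast
    then show ?thesis using \<open>open C\<close> open_contains_cball by blast
  qed
  then obtain z r where zr: "\<And>x. x \<in> K \<Longrightarrow> 0 < r x \<and> cball (z x) (r x) \<subseteq> C \<and> p (z x) = x"
    by metis
  have "open (p ` ball (z x) (r x))" if "x \<in> K" for x
  proof -
    have "openin (top_of_set C) (ball (z x) (r x))"
      unfolding openin_open_eq [OF \<open>open C\<close>]
      using zr [OF that] ball_subset_cball [of "z x" "r x"] by auto
    then have "openin (top_of_set S) (p ` ball (z x) (r x))"
      by (rule covering_space_open_map [OF cov])
    then show ?thesis using \<open>open S\<close> by (rule openin_open_trans)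
  qed
  moreover have "K \<subseteq> (\<Union>x\<in>K. p ` ball (z x) (r x))"
  proof
    fix x assume "x \<in> K"
    then have "x = p (z x)" "z x \<in> ball (z x) (r x)" using zr by auto
    then show "x \<in> (\<Union>x\<in>K. p ` ball (z x) (r x))" using \<open>x \<in> K\<close> by blast
  qed
  ultimately obtain F where F: "F \<subseteq> K" "finite F" "K \<subseteq> (\<Union>x\<in>F. p ` ball (z x) (r x))"
    by (rule compactE_image [OF K(1)])
  show thesis
  proof (rule that [of "\<Union>x\<in>F. cball (z x) (r x)"])
    show "K \<subseteq> p ` (\<Union>x\<in>F. cball (z x) (r x))"
    proof -
      have "(\<Union>x\<in>F. p ` ball (z x) (r x)) \<subseteq> (\<Union>x\<in>F. p ` cball (z x) (r x))"
        by (intro UN_mono image_mono ball_subset_cball order_refl)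
      then show ?thesis using F(3) by (simp add: image_UN)
    qed
      show "compact (\<Union>x\<in>F. cball (z x) (r x))" using F(2) by (intro compact_UN) auto
    show "(\<Union>x\<in>F. cball (z x) (r x)) \<subseteq> C" using F(1) zr by blast
  qed
qed

text \<open>Used in contrapositive form, to find points outside \<open>U\<close> of arbitrarily
  large modulus. Unboundedness puts infinity on the boundary, while the exterior of the disc is
  interior to \<open>S\<close> and so contains no other boundary point.\<close>

lemma isolated_at_infinity:
  assumes unbounded: "\<And>R. \<exists>w\<in>S. R < norm w" and R: "\<And>w. R < norm w \<Longrightarrow> w \<in> S"
  shows "isolated_point_of riemann_sphere (riemann_sphere frontier_of (Some ` S)) None"
proof -
  have unb: "\<exists>w\<in>S. Some w \<in> T" if T: "openin riemann_sphere T" "None \<in> T" for T :: "complex option set"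
  proof -
    obtain C where C: "compact C" "T = insert None (Some ` (- C))"
      using T by (auto simp: openin_Alexandroff_compactification Compl_eq_Diff_UNIV)
    obtain B where B: "\<And>x. x \<in> C \<Longrightarrow> norm x \<le> B"
      using C(1) compact_imp_bounded bounded_iff by metis
    obtain w where "w \<in> S" "B < norm w" using unbounded by blast
    then show ?thesis using B C(2) by force
  qed
  have "None \<in> riemann_sphere closure_of (Some ` S)"
    using unb by (auto simp: in_closure_of)
  moreover have "None \<notin> riemann_sphere interior_of (Some ` S)"
    using interior_of_subset by (metis image_iff option.distinct(1) subsetD)
  ultimately have "None \<in> riemann_sphere frontier_of (Some ` S)"
    by (simp add: frontier_of_def)
  moreover have "None \<notin> riemann_sphere derived_set_of (riemann_sphere frontier_of (Some ` S))"
  proof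
    define V where "V = {w::complex. R < norm w}"
    define T where "T = insert None (Some ` V)"
    have "open V" unfolding V_def by (intro open_Collect_less continuous_intros)
    then have "openin riemann_sphere (Some ` V)"
      by (auto simp: openin_Alexandroff_compactification)
    then have "Some ` V \<subseteq> riemann_sphere interior_of (Some ` S)"
      using R by (intro interior_of_maximal) (auto simp: V_def)
    then have disj: "Some ` V \<inter> riemann_sphere frontier_of (Some ` S) = {}"
      by (auto simp: frontier_of_def)
    have "V = UNIV - cball 0 R" by (auto simp: V_def)
    then have "openin riemann_sphere T"
      unfolding T_def openin_Alexandroff_compactification
      by (intro disjI2 exI [of _ "cball 0 R"]) auto
    moreover assume "None \<in> riemann_sphere derived_set_of (riemann_sphere frontier_of (Some ` S))"
    ultimately obtain y where "y \<noteq> None" "y \<in> riemann_sphere frontier_of (Some ` S)" "y \<in> T"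
      unfolding in_derived_set_of T_def by (metis insertI1)
    then show False using disj by (auto simp: T_def)
  qed
  ultimately show ?thesis by (simp add: isolated_point_of_def)
qed

subsection \<open>Injectivity and the absorbing domain\<close>

context shift_model
begin

text \<open>The sign condition is a normalisation: for \<open>\<tau> \<noteq> 0\<close> it holds for
  exactly one of \<open>\<tau>\<close> and \<open>- \<tau>\<close>, and exchanging the two colliding
  points changes the sign of the period.\<close>

lemma no_period:
  assumes ab: "a \<notin> U" "b \<notin> U" "a \<noteq> b" and no_nhd: "\<And>R. \<exists>w. R < norm w \<and> w \<notin> U"
    and \<tau>: "Im \<tau> > 0 \<or> Im \<tau> = 0 \<and> Re \<tau> > 0"
    and per: "\<And>K. compact K \<Longrightarrow> \<exists>n. \<forall>m\<ge>n. \<forall>\<omega>\<in>K. h (\<omega> + of_nat m + \<tau>) = h (\<omega> + of_nat m)"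
  shows False
proof -
  have inf: "\<exists>N. \<forall>\<omega>. N \<le> Re \<omega> \<and> \<bar>Im \<omega>\<bar> \<le> k \<longrightarrow> \<omega> \<in> D \<and> R < norm (h \<omega>)" for k R
    by (rule half_strip) (rule h_to_infinity)
  have strip: "\<exists>N. \<forall>\<omega>. N \<le> Re \<omega> \<and> \<bar>Im \<omega>\<bar> \<le> k \<longrightarrow> \<omega> \<in> D \<and> h (\<omega> + \<tau>) = h \<omega>" for k
  proof -
    obtain N1 where N1: "\<And>\<omega>. N1 \<le> Re \<omega> \<Longrightarrow> \<bar>Im \<omega>\<bar> \<le> k \<Longrightarrow> \<omega> \<in> D"
      using inf [of k 0] by blast
    obtain N2 where N2: "\<And>\<omega>. N2 \<le> Re \<omega> \<Longrightarrow> \<bar>Im \<omega>\<bar> \<le> k \<Longrightarrow> h (\<omega> + \<tau>) = h \<omega>"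
      using half_strip [of "\<lambda>\<omega>. h (\<omega> + \<tau>) = h \<omega>", OF per] by blast
    show ?thesis using N1 N2 by (intro exI [of _ "max N1 N2"]) auto
  qed
  show False
  proof (cases "Im \<tau> > 0")
    case True
    have "filterlim (\<lambda>n. h (of_nat n)) at_infinity sequentially"
      unfolding filterlim_at_infinity [OF order_refl]
    proof (intro allI impI)
      fix R :: real
      obtain N where N: "\<And>\<omega>. N \<le> Re \<omega> \<Longrightarrow> \<bar>Im \<omega>\<bar> \<le> 0 \<Longrightarrow> R < norm (h \<omega>)"
        using inf [of 0 R] by blast
      show "\<forall>\<^sub>F n in sequentially. R \<le> norm (h (of_nat n))"
        using eventually_ge_at_top [of "nat \<lceil>N\<rceil>"]
      proof eventually_elim
        case (elim n)
        then have "N \<le> real n" by linarith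
        then show ?case using N [of "of_nat n"] by simp
      qed
    qed
    then obtain R where "\<And>w. R < norm w \<Longrightarrow> w \<in> h ` D"
      using periodic_near_infinity_image [OF open_D hol_h ab(3) _ True strip] h_U ab by metis
    then show False using no_nhd [of R] h_U by blast
  next
    case False
    then have \<tau>: "Im \<tau> = 0" "Re \<tau> > 0" using \<tau> by auto
    obtain N where N: "\<And>\<omega>. N \<le> Re \<omega> \<Longrightarrow> \<bar>Im \<omega>\<bar> \<le> 0 \<Longrightarrow> h (\<omega> + \<tau>) = h \<omega>"
      using strip [of 0] by blast
    define \<omega> where "\<omega> = complex_of_real N"
    have h\<omega>: "h (\<omega> + of_nat j * \<tau>) = h \<omega>" for j
    proof (induction j)
      case (Suc j)
      have "h (\<omega> + of_nat j * \<tau> + \<tau>) = h (\<omega> + of_nat j * \<tau>)"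
        using \<tau> by (intro N) (auto simp: \<omega>_def)
      then show ?case using Suc by (simp add: algebra_simps)
    qed simp
    obtain M where M: "\<And>\<omega>'. M \<le> Re \<omega>' \<Longrightarrow> \<bar>Im \<omega>'\<bar> \<le> 0 \<Longrightarrow> norm (h \<omega>) < norm (h \<omega>')"
      using inf [of 0 "norm (h \<omega>)"] by blast
    obtain j where "M - N < real j * Re \<tau>" using \<tau>(2) reals_Archimedean3 by blast
    then have "norm (h \<omega>) < norm (h (\<omega> + of_nat j * \<tau>))"
      using \<tau> by (intro M) (auto simp: \<omega>_def)
    then show False by (simp add: h\<omega>)
  qed
qed

lemma inj_h:
  assumes ab: "a \<notin> U" "b \<notin> U" "a \<noteq> b" and no_nhd: "\<And>R. \<exists>w. R < norm w \<and> w \<notin> U"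
  shows "inj_on h D"
proof (rule inj_onI, rule ccontr)
  fix x y assume xy: "x \<in> D" "y \<in> D" "h x = h y" "x \<noteq> y"
  have "x - y \<noteq> 0" using xy by simp
  then have "Re (x - y) \<noteq> 0 \<or> Im (x - y) \<noteq> 0" by (simp add: complex_eq_iff)
  then consider "Im (y - x) > 0 \<or> Im (y - x) = 0 \<and> Re (y - x) > 0"
    | "Im (x - y) > 0 \<or> Im (x - y) = 0 \<and> Re (x - y) > 0"
    by fastforce
  then show False
  proof cases
    case 1
    then show False
      using no_period [OF ab no_nhd 1] collision_period [of x y] xy by blast
  next
    case 2
    then show False
      using no_period [OF ab no_nhd 2] collision_period [of y x] xy by (metis)
  qed
qed

section \<open>Construction of the nice absorbing domain\<close>

text \<open>Through \<open>h\<close>, niceness of \<open>W\<close> becomes a statement about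
  translates of a plane region, once closures are known to commute with \<open>h\<close>. That
  follows from properness of \<open>h\<close> on the closed region \<open>E\<close>.\<close>

lemma nice_simply_connected_absorbing:
  assumes inj: "inj_on h D" and "open U" and f_maps: "f ` U \<subseteq> U"
  shows "\<exists>W. nice_absorbing_domain W U f \<and> simply_connected W"
proof -
  have "\<exists>N. \<forall>\<omega>. N \<le> Re \<omega> \<and> \<bar>Im \<omega>\<bar> \<le> real k \<longrightarrow> \<omega> \<in> D \<and> real k < norm (h \<omega>)" for k
    by (rule half_strip) (rule h_to_infinity)
  then obtain N where N: "\<And>k \<omega>. N k \<le> Re \<omega> \<Longrightarrow> \<bar>Im \<omega>\<bar> \<le> real k \<Longrightarrow> \<omega> \<in> D \<and> real k < norm (h \<omega>)"
    by metis
  obtain F :: "real \<Rightarrow> real" where F: "continuous_on UNIV F" "convex_on UNIV F" "\<And>y. 0 \<le> F y"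
    "\<And>y. \<exists>k. \<bar>y\<bar> \<le> real k \<and> N k \<le> F y"
    using convex_majorant [of N] by blast
  define E where "E = {\<omega>. F (Im \<omega>) \<le> Re \<omega>}"
  define Q where "Q = {\<omega>. F (Im \<omega>) < Re \<omega>}"
  have contF: "continuous_on UNIV (\<lambda>\<omega>. F (Im \<omega>))"
    by (intro continuous_on_compose2 [OF F(1)] continuous_intros) auto
  have "closed E" unfolding E_def by (intro closed_Collect_le contF continuous_intros)
  have "open Q" unfolding Q_def by (intro open_Collect_less contF continuous_intros)
  have "Q \<subseteq> E" by (auto simp: Q_def E_def)
  have clQ: "closure Q \<subseteq> E" using \<open>closed E\<close> \<open>Q \<subseteq> E\<close> by (rule closure_minimal [rotated])
  \<comment> \<open>The majorant supplies a \<open>k\<close> with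
    \<open>\<bar>Im \<omega>\<bar> \<le> k\<close> and \<open>N k \<le> Re \<omega>\<close>, and
    there \<open>h \<omega>\<close> exceeds \<open>k\<close> in modulus.\<close>
  have E_D: "\<omega> \<in> D" and E_Im: "\<bar>Im \<omega>\<bar> < norm (h \<omega>)" if "\<omega> \<in> E" for \<omega>
  proof -
    obtain k where "\<bar>Im \<omega>\<bar> \<le> real k" "N k \<le> F (Im \<omega>)" using F(4) by blast
    then show "\<omega> \<in> D" "\<bar>Im \<omega>\<bar> < norm (h \<omega>)"
      using N [of k \<omega>] that by (auto simp: E_def)
  qed
  have "convex Q"
    unfolding convex_alt
  proof (intro ballI allI impI)
    fix x y and t :: real assume xy: "x \<in> Q" "y \<in> Q" and t: "0 \<le> t \<and> t \<le> 1"
    have "F (Im ((1 - t) *\<^sub>R x + t *\<^sub>R y)) \<le> (1 - t) * F (Im x) + t * F (Im y)"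
      using convex_onD [OF F(2), of t "Im x" "Im y"] t by simp
    also have "\<dots> < (1 - t) * Re x + t * Re y"
    proof (cases "t = 0")
      case False
      then have "t * F (Im y) < t * Re y" using t xy by (simp add: Q_def)
      moreover have "(1 - t) * F (Im x) \<le> (1 - t) * Re x"
        using t xy by (intro mult_left_mono) (auto simp: Q_def)
      ultimately show ?thesis by linarith
    qed (use xy in \<open>simp add: Q_def\<close>)
    finally show "(1 - t) *\<^sub>R x + t *\<^sub>R y \<in> Q" by (simp add: Q_def)
  qed
  have "Complex (F 0 + 1) 0 \<in> Q" by (simp add: Q_def)
  have contE: "continuous_on S h" if "S \<subseteq> E" for S
    using that E_D by (intro continuous_on_subset [OF holomorphic_on_imp_continuous_on [OF hol_h]]) auto
  \<comment> \<open>If \<open>h \<omega>\<close> is bounded by \<open>R\<close>, then so is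
    \<open>\<bar>Im \<omega>\<bar>\<close>, and \<open>Re \<omega>\<close> lies between
    \<open>0\<close> and \<open>N k\<close> for \<open>k \<ge> R\<close>. Preimages of a convergent
    sequence therefore stay in a compact rectangle.\<close>
  have closed_image: "closed (h ` S)" if S: "closed S" "S \<subseteq> E" for S
    unfolding closed_sequential_limits
  proof (intro allI impI)
    fix x l assume x: "(\<forall>n. x n \<in> h ` S) \<and> x \<longlonglongrightarrow> l"
    then obtain R where R: "\<And>n. norm (x n) \<le> R"
      using convergent_imp_bounded bounded_iff by (metis rangeI)
    define k where "k = nat \<lceil>R\<rceil>"
    have Rk: "R \<le> real k" unfolding k_def by linarith
    define C where "C = S \<inter> cbox (Complex 0 (- R)) (Complex (N k) R)"
    have "compact C" unfolding C_def using S(1) by (intro closed_Int_compact compact_cbox)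
    then have "compact (h ` C)"
      using contE [of C] S(2) by (intro compact_continuous_image) (auto simp: C_def)
    moreover have "x n \<in> h ` C" for n
    proof -
      obtain \<omega> where \<omega>: "\<omega> \<in> S" "x n = h \<omega>" using x by blast
      have "\<bar>Im \<omega>\<bar> \<le> R" using E_Im [of \<omega>] \<omega> S(2) R [of n] by auto
      moreover have "0 \<le> Re \<omega>" using \<omega>(1) S(2) F(3) [of "Im \<omega>"] by (auto simp: E_def)
      moreover have "Re \<omega> \<le> N k"
      proof (rule ccontr)
        assume "\<not> Re \<omega> \<le> N k"
        then have "real k < norm (h \<omega>)" using N [of k \<omega>] \<open>\<bar>Im \<omega>\<bar> \<le> R\<close> Rk by auto
        then show False using \<omega>(2) R [of n] Rk by simp
      qed
      ultimately have "\<omega> \<in> C" using \<omega>(1) by (simp add: C_def in_cbox_complex_iff abs_le_iff)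
      then show ?thesis using \<omega>(2) by blast
    qed
    ultimately have "l \<in> h ` C"
      using x closed_sequentially [OF compact_imp_closed] by blast
    then show "l \<in> h ` S" by (auto simp: C_def)
  qed
  have closure_image: "closure (h ` S) = h ` closure S" if "S \<subseteq> E" for S
  proof
    have cl: "closure S \<subseteq> E" using that \<open>closed E\<close> by (rule closure_minimal)
    show "closure (h ` S) \<subseteq> h ` closure S"
      using closed_image [OF closed_closure cl] closure_subset by (intro closure_minimal image_mono) auto
    show "h ` closure S \<subseteq> closure (h ` S)"
      using contE [OF cl] by (intro image_closure_subset closure_subset) auto
  qed
  have iter_image: "(f ^^ n) ` h ` S = h ` ((+) (of_nat n) ` S)" if "S \<subseteq> E" for n S
    unfolding image_image using that E_D
    by (intro image_cong refl) (metis add.commute h_shift subsetD)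
  have E_shift: "of_nat n + \<omega> \<in> E" if "\<omega> \<in> E" for n \<omega>
    using that by (simp add: E_def)
  have EQ_shift: "1 + \<omega> \<in> Q" if "\<omega> \<in> E" for \<omega>
    using that by (simp add: E_def Q_def)
  define W where "W = h ` Q"
  have "open W"
    unfolding W_def
  proof (rule open_mapping_thm3)
    show "h holomorphic_on Q" "inj_on h Q"
      using E_D \<open>Q \<subseteq> E\<close> by (auto intro: holomorphic_on_subset [OF hol_h] inj_on_subset [OF inj])
  qed fact
  have "connected W"
    unfolding W_def using contE \<open>Q \<subseteq> E\<close> convex_connected [OF \<open>convex Q\<close>]
    by (intro connected_continuous_image)
  have "W \<noteq> {}" using \<open>Complex (F 0 + 1) 0 \<in> Q\<close> by (auto simp: W_def)
  have clW: "closure W = h ` closure Q" unfolding W_def using \<open>Q \<subseteq> E\<close> by (rule closure_image)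
  have clW_U: "closure W \<subseteq> U" unfolding clW using clQ E_D h_U by blast
  have "f ` W \<subseteq> W"
    using iter_image [OF \<open>Q \<subseteq> E\<close>, of 1] EQ_shift \<open>Q \<subseteq> E\<close> by (auto simp: W_def)
  \<comment> \<open>Lift \<open>K\<close> to a compact subset of the half-plane, let
    \<open>g\<close> carry it into \<open>V\<close>, and pass to the coordinate
    \<open>\<Phi>\<close>. On the resulting compact set \<open>F (Im \<omega>) - Re \<omega>\<close>
    is bounded, so a large translation leads into \<open>Q\<close>.\<close>
  have absorb: "\<exists>n. (f ^^ n) ` K \<subseteq> W" if K: "compact K" "K \<subseteq> U" for K
  proof -
    obtain L where L: "compact L" "L \<subseteq> H" "K \<subseteq> \<pi> ` L"
      using covering_space_compact_lift [OF cov right_half_plane_convex_open(2) \<open>open U\<close> K] by blast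
    obtain n where n: "(g ^^ n) ` L \<subseteq> V" using absorbs_V L by blast
    define C where "C = \<Phi> ` (g ^^ n) ` L"
    have "continuous_on L (g ^^ n)"
    proof (induction n)
      case (Suc n)
      have "(g ^^ n) ` L \<subseteq> H" using L(2) iter_H by auto
      then show ?case
        using continuous_on_compose [OF Suc.IH continuous_on_subset [OF cont_g]] by simp
    qed (simp add: id_def)
    then have "compact C"
      unfolding C_def using L(1) n V(2)
      by (intro compact_continuous_image [OF continuous_on_subset [OF holomorphic_on_imp_continuous_on [OF hol_Phi]]]
          compact_continuous_image [of L]) auto
    have "\<exists>m. \<forall>\<omega>\<in>C. \<omega> + of_nat m \<in> Q"
    proof -
      have "continuous_on UNIV (\<lambda>\<omega>. F (Im \<omega>) - Re \<omega>)"
        by (intro continuous_on_diff contF continuous_intros)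
      then have "bounded ((\<lambda>\<omega>. F (Im \<omega>) - Re \<omega>) ` C)"
        using \<open>compact C\<close> by (meson compact_continuous_image compact_imp_bounded continuous_on_subset subset_UNIV)
      then obtain B where B: "\<And>\<omega>. \<omega> \<in> C \<Longrightarrow> \<bar>F (Im \<omega>) - Re \<omega>\<bar> \<le> B"
        unfolding bounded_iff by auto
      have "\<omega> + of_nat (nat \<lceil>B\<rceil> + 1) \<in> Q" if "\<omega> \<in> C" for \<omega>
        using B [OF that] by (simp add: Q_def) linarith
      then show ?thesis by blast
    qed
    then obtain m where m: "\<And>\<omega>. \<omega> \<in> C \<Longrightarrow> \<omega> + of_nat m \<in> Q" by blast
    have "(f ^^ (m + n)) x \<in> W" if "x \<in> K" for x
    proof -
      obtain z where z: "z \<in> L" "x = \<pi> z" using L(3) \<open>x \<in> K\<close> by blast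
      define \<omega> where "\<omega> = \<Phi> ((g ^^ n) z)"
      have \<omega>: "\<omega> \<in> D" "\<psi> \<omega> = (g ^^ n) z" "\<omega> \<in> C"
        using n z by (auto simp: \<omega>_def D_def C_def psi_Phi)
      have "(f ^^ (m + n)) x = (f ^^ m) (h \<omega>)"
        using z L(2) \<omega>(2) by (auto simp: funpow_add h_def pi_iter)
      also have "\<dots> = h (\<omega> + of_nat m)" using h_shift \<omega>(1) by simp
      also have "\<dots> \<in> W" using m \<omega>(3) by (auto simp: W_def)
      finally show ?thesis .
    qed
    then show ?thesis by blast
  qed
  have iterates: "(f ^^ n) ` closure W = closure ((f ^^ n) ` W) \<and> closure ((f ^^ n) ` W) \<subseteq> (f ^^ (n - 1)) ` W"
    if "n \<ge> 1" for n
  proof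
    have "closure ((f ^^ n) ` W) = closure (h ` ((+) (of_nat n) ` Q))"
      unfolding W_def using iter_image [OF \<open>Q \<subseteq> E\<close>] by simp
    also have "\<dots> = h ` closure ((+) (of_nat n) ` Q)"
      using E_shift \<open>Q \<subseteq> E\<close> by (intro closure_image) auto
    also have "\<dots> = h ` ((+) (of_nat n) ` closure Q)" by (simp only: closure_translation)
    finally have *: "closure ((f ^^ n) ` W) = h ` ((+) (of_nat n) ` closure Q)" .
    then show "(f ^^ n) ` closure W = closure ((f ^^ n) ` W)"
      unfolding clW using iter_image [OF clQ] by simp
    \<comment> \<open>One of the \<open>n\<close> unit steps is spent on moving the closure of
      \<open>Q\<close> into \<open>Q\<close> itself.\<close>
    have "(+) (of_nat n) ` closure Q \<subseteq> (+) (of_nat (n - 1)) ` Q"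
    proof (rule image_subsetI)
      fix \<omega> assume "\<omega> \<in> closure Q"
      then have "1 + \<omega> \<in> Q" using clQ EQ_shift by blast
      moreover have "of_nat n + \<omega> = of_nat (n - 1) + (1 + \<omega>)"
        using \<open>n \<ge> 1\<close> by (simp add: of_nat_diff)
      ultimately show "of_nat n + \<omega> \<in> (+) (of_nat (n - 1)) ` Q" by (metis imageI)
    qed
    then show "closure ((f ^^ n) ` W) \<subseteq> (f ^^ (n - 1)) ` W"
      unfolding * unfolding W_def iter_image [OF \<open>Q \<subseteq> E\<close>] by (rule image_mono)
  qed
  have "(\<Inter>n\<in>{1..}. (f ^^ n) ` closure W) = {}"
  proof (rule ccontr)
    assume "(\<Inter>n\<in>{1..}. (f ^^ n) ` closure W) \<noteq> {}"
    then obtain w where w: "w \<in> (\<Inter>n\<in>{1..}. (f ^^ n) ` closure W)" by blast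
    have ex: "\<exists>\<omega>\<in>E. w = h (of_nat n + \<omega>)" if "n \<ge> 1" for n
    proof -
      have "w \<in> (f ^^ n) ` closure W" using w that by blast
      then have "w \<in> h ` ((+) (of_nat n) ` closure Q)" unfolding clW iter_image [OF clQ] .
      then show ?thesis using clQ by blast
    qed
    obtain p where p: "p \<in> E" "w = h (of_nat 1 + p)" using ex [of 1] by blast
    \<comment> \<open>Every point of \<open>n + E\<close> has real part at least \<open>n\<close>,
      and this \<open>n\<close> exceeds \<open>1 + Re p\<close>.\<close>
    define n where "n = nat \<lceil>Re p\<rceil> + 2"
    obtain q where q: "q \<in> E" "w = h (of_nat n + q)" using ex [of n] by (auto simp: n_def)
    have "of_nat 1 + p = of_nat n + q"
    proof (rule inj_onD [OF inj])
      show "h (of_nat 1 + p) = h (of_nat n + q)" using p(2) q(2) by simp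
    qed (intro E_D E_shift p q)+
    from arg_cong [where f = Re, OF this] have "1 + Re p = real n + Re q" by simp
    moreover have "0 \<le> Re q" using q(1) F(3) [of "Im q"] by (simp add: E_def)
    ultimately show False unfolding n_def by linarith
  qed
  moreover have "simply_connected W"
  proof -
    have "Q homeomorphic W"
      unfolding W_def using \<open>open Q\<close> \<open>Q \<subseteq> E\<close> E_D contE
      by (intro invariance_of_domain_homeomorphic inj_on_subset [OF inj]) auto
    then show ?thesis
      using homeomorphic_simply_connected convex_imp_simply_connected [OF \<open>convex Q\<close>] by blast
  qed
  moreover have "absorbing_domain W U f"
    unfolding absorbing_domain_def plane_domain_def
    using \<open>open W\<close> \<open>connected W\<close> \<open>W \<noteq> {}\<close> clW_U closure_subset [of W] \<open>f ` W \<subseteq> W\<close> absorb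
    by (intro conjI allI impI) auto
  ultimately have "nice_absorbing_domain W U f" "simply_connected W"
    unfolding nice_absorbing_domain_def using clW_U iterates by simp_all
  then show ?thesis by blast
qed

end

section \<open>Reduction to the unit translation\<close>

text \<open>If \<open>c \<noteq> 0\<close>, the denominator vanishes at \<open>- d / c\<close>, a
  point of the plane.\<close>

lemma moebius_onto_plane_affine:
  assumes "moebius_onto_self UNIV M"
  obtains \<alpha> \<beta> where "\<alpha> \<noteq> 0" "\<And>z. M z = \<alpha> * z + \<beta>"
proof -
  obtain a b c d where abcd: "a * d - b * c \<noteq> 0" "\<And>z. c * z + d \<noteq> 0" "\<And>z. M z = moebius a b c d z"
    using assms by (auto simp: moebius_onto_self_def)
  have "c = 0"
  proof (rule ccontr)
    assume "c \<noteq> 0"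
    then show False using abcd(2) [of "- d / c"] by simp
  qed
  then have "M z = (a / d) * z + b / d" for z
    by (simp add: abcd(3) moebius_def add_divide_distrib)
  moreover have "a / d \<noteq> 0" using abcd(1) \<open>c = 0\<close> by auto
  ultimately show thesis by (rule that [rotated])
qed

theorem theoremB:
  fixes U :: "complex set" and f :: "complex \<Rightarrow> complex"
  assumes "hyperbolic_domain U"
    and "f holomorphic_on U" and "f ` U \<subseteq> U"
    and "iterates_tend_to_infinity U f"
    and "\<not> isolated_point_of riemann_sphere (riemann_sphere frontier_of (Some ` U)) None"
    and "parabolic_I_type U f"
  shows "\<exists>W. nice_absorbing_domain W U f \<and> simply_connected W"
proof -
  obtain \<pi> g V \<phi> T M where lift: "normalized_lift U f \<pi> g" and model: "cowen_model g V UNIV \<phi> T"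
    and M: "moebius_onto_self UNIV M" and MT: "\<And>\<omega>. M (T \<omega>) = M \<omega> + 1"
    using \<open>parabolic_I_type U f\<close> unfolding parabolic_I_type_def has_cowen_type_def by blast
  obtain \<alpha> \<beta> where \<alpha>: "\<alpha> \<noteq> 0" and M_eq: "\<And>z. M z = \<alpha> * z + \<beta>"
    using moebius_onto_plane_affine [OF M] by blast
  have MT_iter: "M ((T ^^ n) \<omega>) = M \<omega> + of_nat n" for n \<omega>
    by (induction n) (auto simp: MT)
  \<comment> \<open>Composing the Cowen map with \<open>M\<close> replaces \<open>T\<close> by the
    unit translation and keeps injectivity on \<open>V\<close>.\<close>
  interpret shift_model U f \<pi> g V "\<lambda>z. M (\<phi> z)"
  proof
    show "iterates_tend_to_infinity U f" by fact
    show "\<pi> holomorphic_on right_half_plane" "covering_space right_half_plane \<pi> U"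
      "g holomorphic_on right_half_plane" "g ` right_half_plane \<subseteq> right_half_plane"
      "\<And>z. z \<in> right_half_plane \<Longrightarrow> \<pi> (g z) = f (\<pi> z)"
      using lift by (auto simp: normalized_lift_def)
    show "absorbing_domain V right_half_plane g"
      using model by (simp add: cowen_model_def)
    show "(\<lambda>z. M (\<phi> z)) holomorphic_on right_half_plane"
      unfolding M_eq using model by (intro holomorphic_intros) (simp add: cowen_model_def)
    show "M (\<phi> (g z)) = M (\<phi> z) + 1" if "z \<in> right_half_plane" for z
      using model that by (simp add: cowen_model_def MT)
    show "inj_on (\<lambda>z. M (\<phi> z)) V"
      using model \<alpha> by (auto simp: cowen_model_def M_eq inj_on_def)
    show "\<exists>n. \<forall>\<omega>\<in>K. \<omega> + of_nat n \<in> (\<lambda>z. M (\<phi> z)) ` V" if "compact K" for K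
    proof -
      \<comment> \<open>The preimage of \<open>K\<close> under \<open>M\<close>, to which absorption
        for \<open>T\<close> applies.\<close>
      define L where "L = (\<lambda>\<omega>. (\<omega> - \<beta>) / \<alpha>) ` K"
      have "compact L"
        unfolding L_def using that \<alpha> by (intro compact_continuous_image continuous_intros) auto
      then obtain n where n: "(T ^^ n) ` L \<subseteq> \<phi> ` V"
        using model by (auto simp: cowen_model_def absorbing_domain_def)
      have "\<omega> + of_nat n \<in> (\<lambda>z. M (\<phi> z)) ` V" if "\<omega> \<in> K" for \<omega>
      proof -
        obtain v where v: "v \<in> V" "(T ^^ n) ((\<omega> - \<beta>) / \<alpha>) = \<phi> v"
          using n \<open>\<omega> \<in> K\<close> by (auto simp: L_def)
        have "M (\<phi> v) = \<omega> + of_nat n"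
          unfolding v(2) [symmetric] MT_iter using \<alpha> by (simp add: M_eq)
        then show ?thesis using v(1) by (metis imageI)
      qed
      then show ?thesis by blast
    qed
  qed
  obtain a b where ab: "a \<notin> U" "b \<notin> U" "a \<noteq> b" and "open U"
    using \<open>hyperbolic_domain U\<close> by (auto simp: hyperbolic_domain_def plane_domain_def)
  \<comment> \<open>The values of \<open>h\<close> at large integers lie in \<open>U\<close> and
    tend to infinity.\<close>
  have unbounded: "\<exists>w\<in>U. R < norm w" for R
  proof -
    obtain n where n: "R < norm (h (0 + of_nat n))" "0 + of_nat n \<in> D"
      using h_to_infinity [of "{0}" R] by auto
    then show ?thesis using h_U by blast
  qed
  have "\<exists>w. R < norm w \<and> w \<notin> U" for R
    using isolated_at_infinity [OF unbounded] assms(5) by blast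
  then have "inj_on h D" by (rule inj_h [OF ab])
  then show ?thesis using \<open>open U\<close> \<open>f ` U \<subseteq> U\<close> by (rule nice_simply_connected_absorbing)
qed

end
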